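(* Let $\boldsymbol{F}_1,\boldsymbol{F}_2,\boldsymbol{F}_3,\boldsymbol{F}_4$ be the simplicial complexes whose sets of maximal edges are $\mathcal{E}(\boldsymbol{F}_1)=\{\{1,2,3\},\{1,4,5\},\{3,4\},\{3,5\}\}$, $\mathcal{E}(\boldsymbol{F}_2)=\{\{1,2,3\},\{4,5,6\},\{1,4\},\{1,5\},\{1,6\}\}$, $\mathcal{E}(\boldsymbol{F}_3)=\{\{1,2,3\},\{4,5,6\},\{1,4\},\{1,5\},\{2,4\},\{2,5\}\}$, $\mathcal{E}(\boldsymbol{F}_4)=\{\{1,2,3\},\{4,5,6\},\{1,4\},\{1,6\},\{2,4\},\{2,5\},\{3,5\},\{3,6\}\}$. Then none of $\boldsymbol{F}_1,\dots,\boldsymbol{F}_4$ is trivial, and $\mathrm{ex}(n,\boldsymbol{F}_1)=n^3/27+o(n^3)$, $\mathrm{ex}(n,\boldsymbol{F}_2)=n^3/27+o(n^3)$, $\mathrm{ex}(n,\boldsymbol{F}_3)=\Theta(n^3)$, and $\mathrm{ex}(n,\boldsymbol{F}_4)=\Omega(n^{5/2})$ and $\mathrm{ex}(n,\boldsymbol{F}_4)=O(n^{15/4})$.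
   Context: An (abstract) simplicial complex is a hypergraph whose edge set contains all singletons and is closed under taking subsets (the empty set is also an edge); it is determined by its set $\mathcal{E}$ of maximal edges. The dimension is the maximum edge size minus $1$; each $\boldsymbol F_i$ above is $2$-dimensional. $\boldsymbol{F}^3$ denotes the $3$-uniform hypergraph of $3$-element edges of $\boldsymbol{F}$. A simplicial complex is $\boldsymbol{F}$-free if it contains no isomorphic copy of $\boldsymbol{F}$, and $\mathrm{ex}(n,\boldsymbol{F})$ is the maximum number of edges of an $\boldsymbol{F}$-free simplicial complex on $n$ vertices. Given a $3$-uniform hypergraph $G$, $T\subseteq V(G)$ is a clique if $T$ is a singleton, or a subset of some edge, or all its $3$-subsets are edges; $\mathrm{ex}_3^{c\ell+}(n,H)$ is the maximum number of cliques of order at least $3$ in an $n$-vertex $H$-free $3$-uniform hypergraph. A $2$-dimensional simplicial complex $\boldsymbol{F}$ is trivial if for all sufficiently large $n$, $\mathrm{ex}(n,\boldsymbol{F})=\mathrm{ex}_3^{c\ell+}(n,\boldsymbol{F}^3)+\sum_{r=0}^{2}\binom{n}{r}$. *)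

theory Defs
  imports Complex_Main "HOL-Library.Landau_Symbols"
begin

record 'a hgraph =
  verts :: "'a set"
  edges :: "'a set set"

definition hypergraph :: "'a hgraph \<Rightarrow> bool" where
  "hypergraph G \<longleftrightarrow> finite (verts G) \<and> (\<forall>e\<in>edges G. e \<subseteq> verts G)"

definition uniform_hypergraph :: "nat \<Rightarrow> 'a hgraph \<Rightarrow> bool" where
  "uniform_hypergraph r G \<longleftrightarrow> hypergraph G \<and> (\<forall>e\<in>edges G. card e = r)"

text \<open>The empty set is required to be an edge explicitly; for a nonempty vertex set this
  already follows from closure under subsets.\<close>

definition abstract_simplicial_complex :: "'a hgraph \<Rightarrow> bool" where
  "abstract_simplicial_complex K \<longleftrightarrow>
     hypergraph K \<and> {} \<in> edges K \<and> (\<forall>v\<in>verts K. {v} \<in> edges K) \<and>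
     (\<forall>e\<in>edges K. \<forall>s. s \<subseteq> e \<longrightarrow> s \<in> edges K)"

definition dimension :: "'a hgraph \<Rightarrow> int" where
  "dimension K = int (Max (card ` edges K)) - 1"

definition maximal_edges :: "'a hgraph \<Rightarrow> 'a set set" where
  "maximal_edges K = {e \<in> edges K. \<forall>f\<in>edges K. e \<subseteq> f \<longrightarrow> f = e}"

definition complex_of :: "'a set set \<Rightarrow> 'a hgraph" where
  "complex_of M = \<lparr>verts = \<Union>M, edges = {e. \<exists>m\<in>M. e \<subseteq> m}\<rparr>"

definition uniform_part :: "nat \<Rightarrow> 'a hgraph \<Rightarrow> 'a hgraph" where
  "uniform_part r K = \<lparr>verts = verts K, edges = {e \<in> edges K. card e = r}\<rparr>"

definition isomorphic :: "'a hgraph \<Rightarrow> 'b hgraph \<Rightarrow> bool" where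
  "isomorphic F G \<longleftrightarrow>
     (\<exists>\<phi>. bij_betw \<phi> (verts F) (verts G) \<and> edges G = (\<lambda>e. \<phi> ` e) ` edges F)"

definition subhypergraph :: "'a hgraph \<Rightarrow> 'a hgraph \<Rightarrow> bool" where
  "subhypergraph F G \<longleftrightarrow> hypergraph F \<and> verts F \<subseteq> verts G \<and> edges F \<subseteq> edges G"

text \<open>Copies are not required to be induced.\<close>

definition free_of :: "'a hgraph \<Rightarrow> 'b hgraph \<Rightarrow> bool" where
  "free_of G F \<longleftrightarrow> \<not> (\<exists>F'. subhypergraph F' G \<and> isomorphic F F')"

text \<open>In the two extremal functions the vertices are taken from the natural numbers, which
  is no restriction, as every finite hypergraph is isomorphic to one of this kind. The empty
  set counts as an edge of a complex. The sets of values are bounded by \<open>2 ^ n\<close>; they can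
  only be empty if \<open>F\<close> has no edge with two elements (respectively \<open>H\<close> has no edge).\<close>

definition ex_complex :: "nat \<Rightarrow> 'a hgraph \<Rightarrow> nat" where
  "ex_complex n F =
     Max {card (edges K) | K :: nat hgraph.
            abstract_simplicial_complex K \<and> card (verts K) = n \<and> free_of K F}"

definition clique3 :: "'a hgraph \<Rightarrow> 'a set \<Rightarrow> bool" where
  "clique3 G T \<longleftrightarrow> T \<subseteq> verts G \<and>
     ((\<exists>v. T = {v}) \<or> (\<exists>e\<in>edges G. T \<subseteq> e) \<or> (\<forall>S. S \<subseteq> T \<and> card S = 3 \<longrightarrow> S \<in> edges G))"

definition ex3_clique :: "nat \<Rightarrow> 'a hgraph \<Rightarrow> nat" where
  "ex3_clique n H =
     Max {card {T. clique3 G T \<and> 3 \<le> card T} | G :: nat hgraph.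
            uniform_hypergraph 3 G \<and> card (verts G) = n \<and> free_of G H}"

text \<open>The notion is meant for two-dimensional simplicial complexes \<open>F\<close>; that the four
  complexes below are of this kind is shown at the end of the theory. It is not part of the
  definition, so that being nontrivial cannot be satisfied by violating it.\<close>

definition trivial_complex :: "'a hgraph \<Rightarrow> bool" where
  "trivial_complex F \<longleftrightarrow>
     (\<forall>\<^sub>F n in sequentially.
        ex_complex n F = ex3_clique n (uniform_part 3 F) + (\<Sum>r=0..2. n choose r))"

definition F1 :: "nat hgraph" where
  "F1 = complex_of {{1,2,3}, {1,4,5}, {3,4}, {3,5}}"

definition F2 :: "nat hgraph" where
  "F2 = complex_of {{1,2,3}, {4,5,6}, {1,4}, {1,5}, {1,6}}"

definition F3 :: "nat hgraph" where
  "F3 = complex_of {{1,2,3}, {4,5,6}, {1,4}, {1,5}, {2,4}, {2,5}}"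

definition F4 :: "nat hgraph" where
  "F4 = complex_of {{1,2,3}, {4,5,6}, {1,4}, {1,6}, {2,4}, {2,5}, {3,5}, {3,6}}"

lemma complex_of_simplicial:
  assumes "finite M" "M \<noteq> {}" "\<forall>m\<in>M. finite m"
  shows "abstract_simplicial_complex (complex_of M)"
  using assms
  by (auto simp: abstract_simplicial_complex_def hypergraph_def complex_of_def)

lemma maximal_edges_complex_of:
  assumes "\<forall>m\<in>M. \<forall>m'\<in>M. m \<subseteq> m' \<longrightarrow> m = m'"
  shows "maximal_edges (complex_of M) = M"
  unfolding maximal_edges_def complex_of_def hgraph.simps using assms by blast

lemma dimension_complex_of:
  assumes fin: "finite M" "\<forall>m\<in>M. finite m"
    and le: "\<forall>m\<in>M. card m \<le> Suc d" and ex: "\<exists>m\<in>M. card m = Suc d"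
  shows "dimension (complex_of M) = int d"
proof -
  have sub: "edges (complex_of M) \<subseteq> Pow (\<Union>M)"
    by (auto simp: complex_of_def)
  have "finite (edges (complex_of M))"
    by (rule finite_subset[OF sub]) (use fin in auto)
  moreover have "card e \<le> Suc d" if "e \<in> edges (complex_of M)" for e
  proof -
    obtain m where "m \<in> M" "e \<subseteq> m"
      using \<open>e \<in> edges (complex_of M)\<close> by (auto simp: complex_of_def)
    then show ?thesis
      using fin le card_mono[of m e] by (meson le_trans)
  qed
  moreover have "Suc d \<in> card ` edges (complex_of M)"
    using ex by (force simp: complex_of_def)
  ultimately have "Max (card ` edges (complex_of M)) = Suc d"
    by (intro Max_eqI) auto
  then show ?thesis
    by (simp add: dimension_def)
qed

lemma F_simplicial:
  "abstract_simplicial_complex F1" "abstract_simplicial_complex F2"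
  "abstract_simplicial_complex F3" "abstract_simplicial_complex F4"
  unfolding F1_def F2_def F3_def F4_def by (rule complex_of_simplicial; simp)+

lemma F_dimension: "dimension F1 = 2" "dimension F2 = 2" "dimension F3 = 2" "dimension F4 = 2"
  unfolding F1_def F2_def F3_def F4_def
  by (rule dimension_complex_of[where d = 2, simplified]; simp)+

lemma F_maximal_edges:
  "maximal_edges F1 = {{1,2,3}, {1,4,5}, {3,4}, {3,5}}"
  "maximal_edges F2 = {{1,2,3}, {4,5,6}, {1,4}, {1,5}, {1,6}}"
  "maximal_edges F3 = {{1,2,3}, {4,5,6}, {1,4}, {1,5}, {2,4}, {2,5}}"
  "maximal_edges F4 = {{1,2,3}, {4,5,6}, {1,4}, {1,6}, {2,4}, {2,5}, {3,5}, {3,6}}"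
  unfolding F1_def F2_def F3_def F4_def
  by (rule maximal_edges_complex_of; simp)+

end

theory Submission
  imports Defs "HOL-Analysis.Convex" "HOL-Number_Theory.Prime_Powers" "HOL-Number_Theory.Cong"
    "HOL-Real_Asymp.Real_Asymp"
begin

text \<open>
  \<^emph>\<open>Upper bounds for F1 and F2.\<close> If a triple \<open>abc\<close> is a face and \<open>d\<close> is adjacent to \<open>a\<close>, \<open>b\<close>
  and \<open>c\<close>, then F1-freeness confines all faces through the pair \<open>ad\<close> to \<open>abcd\<close>, and F2-freeness
  makes every face through \<open>d\<close> lie in \<open>abcd\<close> up to one vertex. Only \<open>O(n\<^sup>2)\<close> faces contain such a
  degenerate pair or vertex, among them all faces with at least four vertices. The remaining
  triples form a family \<open>H\<close> in which no vertex is joined, by pairs contained in members of \<open>H\<close>, to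
  all vertices of a member. Hence the sum of the shadow degrees over a member is at most \<open>2 n\<close>, and
  vertex links are triangle-free. With Mantel's theorem and convexity this gives \<open>|H| \<le> n\<^sup>3 / 27\<close>.

  \<^emph>\<open>Upper bounds for F3 and F4.\<close> In an F3-free complex every face with at least four vertices has
  a pair of vertices that lies in boundedly many faces. In an F4-free complex the triples contain
  no complete tripartite \<open>K(2,2,2)\<close>, so there are \<open>O(n powr (11/4))\<close> of them and \<open>O(n powr (15/4))\<close>
  faces with four vertices; each of the latter lies in at most one face with five vertices.

  \<^emph>\<open>Lower bounds.\<close> The 1-skeletons of F1, F2 and F3 contain \<open>K\<^sub>4\<close>, so complete tripartite
  complexes are free of them. For F4 a bipartite \<open>C\<^sub>4\<close>-free graph, the incidence graph of an affine
  plane of prime order, is joined to an independent set; Chebyshev's method provides the primes.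

  \<^emph>\<open>Nontriviality.\<close> A triple system without two disjoint edges, or without two edges meeting in
  exactly one vertex, has only \<open>O(n\<^sup>2)\<close> cliques of order at least 3.
\<close>

section \<open>Copies and extremal numbers\<close>

text \<open>A copy is the image of \<open>F\<close> under an injection of its vertices. The
  assumption on \<open>F\<close> makes this image a hypergraph again, as
  \<open>subhypergraph\<close> demands.\<close>

lemma free_of_iff:
  assumes "hypergraph F"
  shows "free_of G F \<longleftrightarrow> \<not> (\<exists>\<phi>. inj_on \<phi> (verts F) \<and> \<phi> ` verts F \<subseteq> verts G \<and>
    (\<forall>e\<in>edges F. \<phi> ` e \<in> edges G))"
proof -
  have "(\<exists>F'. subhypergraph F' G \<and> isomorphic F F') \<longleftrightarrow>
    (\<exists>\<phi>. inj_on \<phi> (verts F) \<and> \<phi> ` verts F \<subseteq> verts G \<and> (\<forall>e\<in>edges F. \<phi> ` e \<in> edges G))"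
  proof
    assume "\<exists>F'. subhypergraph F' G \<and> isomorphic F F'"
    then obtain F' \<phi> where "subhypergraph F' G" "bij_betw \<phi> (verts F) (verts F')"
      "edges F' = (\<lambda>e. \<phi> ` e) ` edges F"
      unfolding isomorphic_def by blast
    then have "inj_on \<phi> (verts F)" "\<phi> ` verts F \<subseteq> verts G" "\<forall>e\<in>edges F. \<phi> ` e \<in> edges G"
      by (auto simp: subhypergraph_def bij_betw_def)
    then show "\<exists>\<phi>. inj_on \<phi> (verts F) \<and> \<phi> ` verts F \<subseteq> verts G \<and> (\<forall>e\<in>edges F. \<phi> ` e \<in> edges G)"
      by blast
  next
    assume "\<exists>\<phi>. inj_on \<phi> (verts F) \<and> \<phi> ` verts F \<subseteq> verts G \<and> (\<forall>e\<in>edges F. \<phi> ` e \<in> edges G)"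
    then obtain \<phi> where \<phi>: "inj_on \<phi> (verts F)" "\<phi> ` verts F \<subseteq> verts G"
      "\<forall>e\<in>edges F. \<phi> ` e \<in> edges G" by blast
    let ?F' = "\<lparr>verts = \<phi> ` verts F, edges = (\<lambda>e. \<phi> ` e) ` edges F\<rparr>"
    have "subhypergraph ?F' G"
      using assms \<phi> unfolding subhypergraph_def hypergraph_def by fastforce
    moreover have "isomorphic F ?F'"
      using \<phi> by (auto simp: isomorphic_def bij_betw_def)
    ultimately show "\<exists>F'. subhypergraph F' G \<and> isomorphic F F'" by blast
  qed
  then show ?thesis by (simp add: free_of_def)
qed

text \<open>Faces of \<open>K\<close> are closed under subsets, so an injection that sends the
  generating sets to faces sends every face of the generated complex to a face.\<close>

lemma free_of_complex_of_iff:
  assumes K: "abstract_simplicial_complex K" and M: "finite M" "\<forall>m\<in>M. finite m"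
  shows "free_of K (complex_of M) \<longleftrightarrow> \<not> (\<exists>\<phi>. inj_on \<phi> (\<Union>M) \<and> (\<forall>m\<in>M. \<phi> ` m \<in> edges K))"
proof -
  have hyp: "hypergraph (complex_of M)"
    using M by (auto simp: hypergraph_def complex_of_def)
  have "(\<phi> ` \<Union>M \<subseteq> verts K \<and> (\<forall>e\<in>edges (complex_of M). \<phi> ` e \<in> edges K)) \<longleftrightarrow>
      (\<forall>m\<in>M. \<phi> ` m \<in> edges K)" for \<phi>
  proof
    assume *: "\<forall>m\<in>M. \<phi> ` m \<in> edges K"
    have "\<phi> ` e \<in> edges K" if "m \<in> M" "e \<subseteq> m" for e m
    proof -
      have "\<phi> ` e \<subseteq> \<phi> ` m" using that by blast
      then show ?thesis
        using * that K unfolding abstract_simplicial_complex_def by blast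
    qed
    moreover have "\<phi> ` \<Union>M \<subseteq> verts K"
      using * K unfolding abstract_simplicial_complex_def hypergraph_def by blast
    ultimately show "\<phi> ` \<Union>M \<subseteq> verts K \<and> (\<forall>e\<in>edges (complex_of M). \<phi> ` e \<in> edges K)"
      by (auto simp: complex_of_def)
  qed (auto simp: complex_of_def)
  then show ?thesis
    unfolding free_of_iff[OF hyp] by (simp add: complex_of_def)
qed

text \<open>Trades embeddings for tuples of distinct vertices, so that forbidden configurations can
  be exhibited by naming their vertices.\<close>

lemma ex_inj_on_5:
  "(\<exists>\<phi>. inj_on \<phi> {1,2,3,4,5::nat} \<and> P (\<phi> 1) (\<phi> 2) (\<phi> 3) (\<phi> 4) (\<phi> 5)) \<longleftrightarrow>
    (\<exists>a b c d e. distinct [a,b,c,d,e] \<and> P a b c d e)" (is "?L \<longleftrightarrow> ?R")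
proof -
  have inj: "inj_on \<phi> {1,2,3,4,5} \<longleftrightarrow> distinct [\<phi> 1, \<phi> 2, \<phi> 3, \<phi> 4, \<phi> 5]" for \<phi> :: "nat \<Rightarrow> 'a"
    using distinct_map[of \<phi> "[1,2,3,4,5]"] by simp
  show ?thesis
  proof
    assume ?L
    then show ?R unfolding inj by blast
  next
    assume ?R
    then obtain a b c d e where "distinct [a,b,c,d,e]" "P a b c d e" by blast
    then show ?L
      \<comment> \<open>The list is padded in front because vertices are numbered from 1 and list
        positions from 0.\<close>
      unfolding inj by (intro exI[of _ "\<lambda>i. [a,a,b,c,d,e] ! i"]) simp
  qed
qed

lemma ex_inj_on_6:
  "(\<exists>\<phi>. inj_on \<phi> {1,2,3,4,5,6::nat} \<and> P (\<phi> 1) (\<phi> 2) (\<phi> 3) (\<phi> 4) (\<phi> 5) (\<phi> 6)) \<longleftrightarrow>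
    (\<exists>a b c d e f. distinct [a,b,c,d,e,f] \<and> P a b c d e f)" (is "?L \<longleftrightarrow> ?R")
proof -
  have inj: "inj_on \<phi> {1,2,3,4,5,6} \<longleftrightarrow> distinct [\<phi> 1, \<phi> 2, \<phi> 3, \<phi> 4, \<phi> 5, \<phi> 6]" for \<phi> :: "nat \<Rightarrow> 'a"
    using distinct_map[of \<phi> "[1,2,3,4,5,6]"] by simp
  show ?thesis
  proof
    assume ?L
    then show ?R unfolding inj by blast
  next
    assume ?R
    then obtain a b c d e f where "distinct [a,b,c,d,e,f]" "P a b c d e f" by blast
    then show ?L
      unfolding inj by (intro exI[of _ "\<lambda>i. [a,a,b,c,d,e,f] ! i"]) simp
  qed
qed

text \<open>In this and the next three characterisations the letters are the images of the vertices
  1, 2, 3, ... in this order.\<close>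

lemma free_of_F1_iff:
  assumes "abstract_simplicial_complex K"
  shows "free_of K F1 \<longleftrightarrow> \<not> (\<exists>a b c d e. distinct [a,b,c,d,e] \<and>
    {a,b,c} \<in> edges K \<and>
    {a,d,e} \<in> edges K \<and>
    {c,d} \<in> edges K \<and>
    {c,e} \<in> edges K)"
proof -
  have "\<Union>{{1,2,3}, {1,4,5}, {3,4}, {3,5}} = {1,2,3,4,5::nat}"
    by auto
  then show ?thesis
    unfolding F1_def by (subst free_of_complex_of_iff[OF assms]) (simp_all only: ex_inj_on_5[symmetric], auto)
qed

lemma free_of_F2_iff:
  assumes "abstract_simplicial_complex K"
  shows "free_of K F2 \<longleftrightarrow> \<not> (\<exists>a b c d e f. distinct [a,b,c,d,e,f] \<and>
    {a,b,c} \<in> edges K \<and>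
    {d,e,f} \<in> edges K \<and>
    {a,d} \<in> edges K \<and>
    {a,e} \<in> edges K \<and>
    {a,f} \<in> edges K)"
proof -
  have "\<Union>{{1,2,3}, {4,5,6}, {1,4}, {1,5}, {1,6}} = {1,2,3,4,5,6::nat}"
    by auto
  then show ?thesis
    unfolding F2_def by (subst free_of_complex_of_iff[OF assms]) (simp_all only: ex_inj_on_6[symmetric], auto)
qed

lemma free_of_F3_iff:
  assumes "abstract_simplicial_complex K"
  shows "free_of K F3 \<longleftrightarrow> \<not> (\<exists>a b c d e f. distinct [a,b,c,d,e,f] \<and>
    {a,b,c} \<in> edges K \<and>
    {d,e,f} \<in> edges K \<and>
    {a,d} \<in> edges K \<and>
    {a,e} \<in> edges K \<and>
    {b,d} \<in> edges K \<and>
    {b,e} \<in> edges K)"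
proof -
  have "\<Union>{{1,2,3}, {4,5,6}, {1,4}, {1,5}, {2,4}, {2,5}} = {1,2,3,4,5,6::nat}"
    by auto
  then show ?thesis
    unfolding F3_def by (subst free_of_complex_of_iff[OF assms]) (simp_all only: ex_inj_on_6[symmetric], auto)
qed

lemma free_of_F4_iff:
  assumes "abstract_simplicial_complex K"
  shows "free_of K F4 \<longleftrightarrow> \<not> (\<exists>a b c d e f. distinct [a,b,c,d,e,f] \<and>
    {a,b,c} \<in> edges K \<and>
    {d,e,f} \<in> edges K \<and>
    {a,d} \<in> edges K \<and>
    {a,f} \<in> edges K \<and>
    {b,d} \<in> edges K \<and>
    {b,e} \<in> edges K \<and>
    {c,e} \<in> edges K \<and>
    {c,f} \<in> edges K)"
proof -
  have "\<Union>{{1,2,3}, {4,5,6}, {1,4}, {1,6}, {2,4}, {2,5}, {3,5}, {3,6}} = {1,2,3,4,5,6::nat}"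
    by auto
  then show ?thesis
    unfolding F4_def by (subst free_of_complex_of_iff[OF assms]) (simp_all only: ex_inj_on_6[symmetric], auto)
qed

lemma card_edges_le_power:
  assumes "hypergraph K"
  shows "card (edges K) \<le> 2 ^ card (verts K)"
proof -
  have "card (edges K) \<le> card (Pow (verts K))"
    using assms by (intro card_mono) (auto simp: hypergraph_def)
  then show ?thesis using assms by (simp add: card_Pow hypergraph_def)
qed

lemma finite_ex_complex_values:
  "finite {card (edges K) | K :: nat hgraph.
     abstract_simplicial_complex K \<and> card (verts K) = n \<and> free_of K F}"
  by (rule finite_subset[of _ "{..2 ^ n}"])
     (auto simp: abstract_simplicial_complex_def intro: card_edges_le_power)

lemma ex_complex_ge:
  fixes K :: "nat hgraph"
  assumes "abstract_simplicial_complex K" "card (verts K) = n" "free_of K F"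
  shows "card (edges K) \<le> ex_complex n F"
  unfolding ex_complex_def
  using assms by (intro Max_ge finite_ex_complex_values) blast

text \<open>A \<open>Max\<close> is bounded by bounding its members only if the set is nonempty. The
  witness is the complex of \<open>n\<close> isolated vertices, which omits every \<open>F\<close>
  with an edge of size at least 2. For \<open>n = 0\<close> this generated complex would lack the
  empty face.\<close>

lemma ex_complex_le:
  fixes F :: "'a hgraph"
  assumes n: "n > 0" and F: "hypergraph F" "e \<in> edges F" "card e \<ge> 2"
    and B: "\<And>K :: nat hgraph. abstract_simplicial_complex K \<Longrightarrow> card (verts K) = n \<Longrightarrow>
      free_of K F \<Longrightarrow> card (edges K) \<le> B"
  shows "ex_complex n F \<le> B"
proof -
  define K :: "nat hgraph" where "K = complex_of ((\<lambda>v. {v}) ` {..<n})"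
  have "abstract_simplicial_complex K"
    unfolding K_def using n by (intro complex_of_simplicial) auto
  moreover have "card (verts K) = n"
    by (simp add: K_def complex_of_def)
  moreover have "free_of K F"
  proof -
    have False if "inj_on \<phi> (verts F)" "\<phi> ` e \<in> edges K" for \<phi>
    proof -
      have "e \<subseteq> verts F" using F by (auto simp: hypergraph_def)
      then have "card (\<phi> ` e) = card e"
        using that by (intro card_image) (rule inj_on_subset)
      moreover have "card (\<phi> ` e) \<le> 1"
        using that by (auto simp: K_def complex_of_def subset_singleton_iff)
      ultimately show False using F by simp
    qed
    then show ?thesis using F by (auto simp: free_of_iff)
  qed
  ultimately have "{card (edges K) | K :: nat hgraph.
     abstract_simplicial_complex K \<and> card (verts K) = n \<and> free_of K F} \<noteq> {}" by blast
  then show ?thesis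
    unfolding ex_complex_def using B finite_ex_complex_values[of n F]
    by (subst Max_le_iff) auto
qed

text \<open>As before, with the edgeless hypergraph as witness; the bound \<open>B\<close> itself
  makes the set of values finite.\<close>

lemma ex3_clique_le:
  fixes H :: "'a hgraph"
  assumes H: "hypergraph H" "edges H \<noteq> {}"
    and B: "\<And>G :: nat hgraph. uniform_hypergraph 3 G \<Longrightarrow> card (verts G) = n \<Longrightarrow>
      free_of G H \<Longrightarrow> card {T. clique3 G T \<and> 3 \<le> card T} \<le> B"
  shows "ex3_clique n H \<le> B"
proof -
  let ?X = "{card {T. clique3 G T \<and> 3 \<le> card T} | G :: nat hgraph.
            uniform_hypergraph 3 G \<and> card (verts G) = n \<and> free_of G H}"
  define G :: "nat hgraph" where "G = \<lparr>verts = {..<n}, edges = {}\<rparr>"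
  have "uniform_hypergraph 3 G" "card (verts G) = n" "free_of G H"
    using H by (auto simp: G_def uniform_hypergraph_def hypergraph_def free_of_iff)
  then have "?X \<noteq> {}" by blast
  moreover have "?X \<subseteq> {..B}" using B by auto
  moreover from this have "finite ?X" by (rule finite_subset) simp
  ultimately show ?thesis
    unfolding ex3_clique_def by (subst Max_le_iff) auto
qed

section \<open>Counting set families\<close>

text \<open>A set of size \<open>Suc k\<close> arises by inserting an element of \<open>V\<close>
  into a set of size \<open>k\<close>, so each step costs a factor of at most
  \<open>card V + 1\<close>.\<close>

lemma card_subsets_le:
  assumes "finite V"
  shows "card {S. S \<subseteq> V \<and> card S \<le> k} \<le> (card V + 1) ^ k"
proof (induction k)
  case 0
  have "{S. S \<subseteq> V \<and> card S \<le> 0} = {{}}"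
    using assms by (auto dest: finite_subset)
  then show ?case by simp
next
  case (Suc k)
  let ?A = "{S. S \<subseteq> V \<and> card S \<le> k}"
  have fin: "finite ?A" using assms by (auto intro: finite_subset[of _ "Pow V"])
  have "{S. S \<subseteq> V \<and> card S \<le> Suc k} \<subseteq> ?A \<union> (\<lambda>(x, S). insert x S) ` (V \<times> ?A)"
  proof
    fix S assume S: "S \<in> {S. S \<subseteq> V \<and> card S \<le> Suc k}"
    show "S \<in> ?A \<union> (\<lambda>(x, S). insert x S) ` (V \<times> ?A)"
    proof (cases "card S \<le> k")
      case False
      then obtain x where "x \<in> S" by fastforce
      moreover have "finite S" using S assms by (auto dest: finite_subset)
      ultimately have "S = insert x (S - {x})" "S - {x} \<in> ?A" "x \<in> V"
        using S by (auto simp: card_Diff_singleton_if)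
      then show ?thesis by (intro UnI2 image_eqI[of _ _ "(x, S - {x})"]) auto
    qed (use S in auto)
  qed
  then have "card {S. S \<subseteq> V \<and> card S \<le> Suc k} \<le>
      card (?A \<union> (\<lambda>(x, S). insert x S) ` (V \<times> ?A))"
    using fin assms by (intro card_mono) auto
  also have "\<dots> \<le> card ?A + card (V \<times> ?A)"
    using fin assms by (intro order_trans[OF card_Un_le] add_left_mono card_image_le) auto
  also have "\<dots> = (card V + 1) * card ?A" by (simp add: card_cartesian_product)
  also have "\<dots> \<le> (card V + 1) ^ Suc k"
    using mult_left_mono[OF Suc.IH, of "card V + 1"] by simp
  finally show ?case .
qed

text \<open>A set is determined by its trace on \<open>B\<close> and its remainder outside
  \<open>B\<close>.\<close>

lemma card_near_le:
  assumes "finite V" "finite B" "\<And>T. T \<in> \<T> \<Longrightarrow> T \<subseteq> V \<and> card (T - B) \<le> k"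
  shows "card \<T> \<le> 2 ^ card B * (card V + 1) ^ k"
proof -
  let ?A = "{S. S \<subseteq> V \<and> card S \<le> k}"
  have fin: "finite ?A" using assms by (auto intro: finite_subset[of _ "Pow V"])
  have "inj_on (\<lambda>T. (T \<inter> B, T - B)) \<T>" by (auto simp: inj_on_def)
  moreover have "(\<lambda>T. (T \<inter> B, T - B)) ` \<T> \<subseteq> Pow B \<times> ?A" using assms by auto
  ultimately have "card \<T> \<le> card (Pow B \<times> ?A)"
    using fin assms by (metis (lifting) card_inj_on_le finite_Pow_iff finite_SigmaI)
  also have "\<dots> = 2 ^ card B * card ?A" using assms by (simp add: card_cartesian_product card_Pow)
  also have "\<dots> \<le> 2 ^ card B * (card V + 1) ^ k" using card_subsets_le[OF assms(1)] by simp
  finally show ?thesis .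
qed

text \<open>The charging device of the proof: each member is charged to an index whose whole class
  stays close to one bounded set. It is applied with pairs and \<open>k = 0\<close>, with vertices
  and \<open>k = 1\<close>, and with a single index and \<open>k = 2\<close>, each time giving a
  quadratic bound.\<close>

lemma card_dominated_le:
  fixes P :: "'i \<Rightarrow> 'a set \<Rightarrow> bool"
  assumes V: "finite V" "\<And>T. T \<in> \<T> \<Longrightarrow> T \<subseteq> V" and I: "finite I"
    and dom: "\<And>T. T \<in> \<T> \<Longrightarrow> \<exists>i\<in>I. P i T \<and>
      (\<exists>B. finite B \<and> card B \<le> b \<and> (\<forall>S\<in>\<T>. P i S \<longrightarrow> card (S - B) \<le> k))"
  shows "card \<T> \<le> card I * (2 ^ b * (card V + 1) ^ k)"
proof -
  let ?J = "{i\<in>I. \<exists>B. finite B \<and> card B \<le> b \<and> (\<forall>S\<in>\<T>. P i S \<longrightarrow> card (S - B) \<le> k)}"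
  have fin: "finite \<T>" using V by (meson PowI finite_Pow_iff finite_subset subsetI)
  have "\<T> \<subseteq> (\<Union>i\<in>?J. {S\<in>\<T>. P i S})"
  proof
    fix T assume "T \<in> \<T>"
    with dom[OF this] show "T \<in> (\<Union>i\<in>?J. {S\<in>\<T>. P i S})" by blast
  qed
  then have "card \<T> \<le> card (\<Union>i\<in>?J. {S\<in>\<T>. P i S})"
    using fin I by (intro card_mono) auto
  also have "\<dots> \<le> (\<Sum>i\<in>?J. card {S\<in>\<T>. P i S})" using I by (intro card_UN_le) auto
  also have "\<dots> \<le> (\<Sum>i\<in>?J. 2 ^ b * (card V + 1) ^ k)"
  proof (intro sum_mono)
    fix i assume "i \<in> ?J"
    then obtain B where B: "finite B" "card B \<le> b" "\<forall>S\<in>\<T>. P i S \<longrightarrow> card (S - B) \<le> k" by auto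
    then have "card {S\<in>\<T>. P i S} \<le> 2 ^ card B * (card V + 1) ^ k"
      using V by (intro card_near_le) auto
    also have "\<dots> \<le> 2 ^ b * (card V + 1) ^ k" using B by (intro mult_right_mono power_increasing) auto
    finally show "card {S\<in>\<T>. P i S} \<le> 2 ^ b * (card V + 1) ^ k" .
  qed
  also have "\<dots> = card ?J * (2 ^ b * (card V + 1) ^ k)" by simp
  also have "\<dots> \<le> card I * (2 ^ b * (card V + 1) ^ k)"
    using I by (intro mult_right_mono card_mono) auto
  finally show ?thesis .
qed

lemma sum_sum_members:
  fixes f :: "'a \<Rightarrow> real"
  assumes "finite V" "finite \<T>" "\<And>T. T \<in> \<T> \<Longrightarrow> T \<subseteq> V"
  shows "(\<Sum>T\<in>\<T>. \<Sum>v\<in>T. f v) = (\<Sum>v\<in>V. real (card {T\<in>\<T>. v \<in> T}) * f v)"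
proof -
  have "(\<Sum>T\<in>\<T>. \<Sum>v\<in>T. f v) = (\<Sum>T\<in>\<T>. \<Sum>v\<in>{v\<in>V. v \<in> T}. f v)"
    using assms by (intro sum.cong) auto
  also have "\<dots> = (\<Sum>v\<in>V. \<Sum>T\<in>{T\<in>\<T>. v \<in> T}. f v)"
    using assms by (intro sum.swap_restrict)
  finally show ?thesis by simp
qed

text \<open>Each vertex is adjacent to at most one end of an edge, so the degrees at the two ends of
  an edge sum to at most \<open>card V\<close>. Summing over all edges bounds the sum of squared
  degrees.\<close>

lemma mantel:
  assumes V: "finite V" and E: "\<And>e. e \<in> E \<Longrightarrow> e \<subseteq> V \<and> card e = 2"
    and tri: "\<And>e u. e \<in> E \<Longrightarrow> u \<in> V \<Longrightarrow> \<exists>w\<in>e. {u, w} \<notin> E"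
  shows "4 * real (card E) \<le> real (card V) ^ 2"
proof -
  have finE: "finite E" using V E by (meson PowI finite_Pow_iff finite_subset subsetI)
  define d where "d = (\<lambda>w. real (card {e\<in>E. w \<in> e}))"
  have d_alt: "d w = real (card {u\<in>V. {u, w} \<in> E})" if "w \<in> V" for w
  proof -
    have "bij_betw (\<lambda>u. {u, w}) {u\<in>V. {u, w} \<in> E} {e\<in>E. w \<in> e}"
    proof (rule bij_betwI')
      fix x y assume "x \<in> {u\<in>V. {u, w} \<in> E}" "y \<in> {u\<in>V. {u, w} \<in> E}"
      show "({x, w} = {y, w}) = (x = y)" by (auto simp: doubleton_eq_iff)
    next
      fix e assume e: "e \<in> {e\<in>E. w \<in> e}"
      then obtain x y where "e = {x, y}" "x \<noteq> y" using E by (metis (lifting) card_2_iff mem_Collect_eq)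
      then obtain x where x: "e = {x, w}" using e by auto
      with e E[of e] show "\<exists>x\<in>{u\<in>V. {u, w} \<in> E}. e = {x, w}" by auto
    qed auto
    then show ?thesis by (simp add: d_def bij_betw_same_card)
  qed
  let ?n = "real (card V)" and ?m = "real (card E)"
  have "(\<Sum>v\<in>V. d v) = (\<Sum>e\<in>E. \<Sum>v\<in>e. 1)"
    using sum_sum_members[of V E "\<lambda>_. 1"] V finE E by (simp add: d_def)
  also have "\<dots> = (\<Sum>e\<in>E. 2)" using E by (intro sum.cong) auto
  finally have sumd: "(\<Sum>v\<in>V. d v) = 2 * ?m" by simp
  have "(\<Sum>v\<in>V. d v * d v) = (\<Sum>e\<in>E. \<Sum>w\<in>e. d w)"
    using sum_sum_members[of V E d] V finE E by (simp add: d_def)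
  also have "\<dots> \<le> (\<Sum>e\<in>E. ?n)"
  proof (rule sum_mono)
    fix e assume e: "e \<in> E"
    have fe: "finite e" using e E V by (meson finite_subset)
    have "(\<Sum>w\<in>e. d w) = (\<Sum>w\<in>e. \<Sum>u\<in>{u\<in>V. {u, w} \<in> E}. 1)"
      using e E d_alt by (intro sum.cong) auto
    also have "\<dots> = (\<Sum>u\<in>V. \<Sum>w\<in>{w\<in>e. {u, w} \<in> E}. 1)"
      by (rule sum.swap_restrict[OF fe V])
    also have "\<dots> \<le> (\<Sum>u\<in>V. 1)"
    proof (rule sum_mono)
      fix u assume "u \<in> V"
      then obtain w where "w \<in> e" "{u, w} \<notin> E" using tri e by blast
      then have "{w\<in>e. {u, w} \<in> E} \<subseteq> e - {w}" by auto
      then have "card {w\<in>e. {u, w} \<in> E} \<le> card (e - {w})" using fe by (intro card_mono) auto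
      then show "(\<Sum>w\<in>{w\<in>e. {u, w} \<in> E}. 1::real) \<le> 1" using e E \<open>w \<in> e\<close> by simp
    qed
    finally show "(\<Sum>w\<in>e. d w) \<le> ?n" by simp
  qed
  finally have upper: "(\<Sum>v\<in>V. d v * d v) \<le> ?m * ?n" by simp
  \<comment> \<open>This is Cauchy-Schwarz in expanded form, centred at n/2, the common degree in a
    balanced complete bipartite graph.\<close>
  have "0 \<le> (\<Sum>v\<in>V. (d v - ?n / 2) ^ 2)" by (intro sum_nonneg) auto
  also have "\<dots> = (\<Sum>v\<in>V. d v * d v - ?n * d v + ?n ^ 2 / 4)"
    by (intro sum.cong) (auto simp: power2_eq_square algebra_simps)
  also have "\<dots> = (\<Sum>v\<in>V. d v * d v) - ?n * (\<Sum>v\<in>V. d v) + ?n * (?n ^ 2 / 4)"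
    by (simp add: sum.distrib sum_subtractf sum_distrib_left)
  finally have "0 \<le> ?n * (?n ^ 2 / 4 - ?m)"
    using upper unfolding sumd by (simp add: algebra_simps)
  then show ?thesis
  proof (cases "card V = 0")
    case True
    then have "E = {}" using V E by fastforce
    then show ?thesis by simp
  next
    case False
    then have "?n > 0" by simp
    with \<open>0 \<le> ?n * (?n ^ 2 / 4 - ?m)\<close> show ?thesis by (simp add: zero_le_mult_iff)
  qed
qed

text \<open>The sum of \<open>h v * d v\<close> over the vertices is evaluated twice: from above by
  summing degrees over members, from below by Mantel's theorem in the links. The constant 27 belongs
  to the balanced complete tripartite system.\<close>

lemma card_triples_no_covered_vertex:
  assumes V: "finite V" and H: "\<And>t. t \<in> H \<Longrightarrow> t \<subseteq> V \<and> card t = 3"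
    and cov: "\<And>t u. t \<in> H \<Longrightarrow> u \<in> V \<Longrightarrow> \<exists>v\<in>t. \<not> (u \<noteq> v \<and> (\<exists>s\<in>H. u \<in> s \<and> v \<in> s))"
  shows "27 * real (card H) \<le> real (card V) ^ 3"
proof -
  define adj where "adj = (\<lambda>u v. u \<noteq> v \<and> (\<exists>s\<in>H. u \<in> s \<and> v \<in> s))"
  have cov': "\<exists>v\<in>t. \<not> adj u v" if "t \<in> H" "u \<in> V" for t u
    using cov[OF that] by (simp add: adj_def)
  have finH: "finite H" using V H by (meson PowI finite_Pow_iff finite_subset subsetI)
  define h where "h = (\<lambda>v. real (card {t\<in>H. v \<in> t}))"
  define N where "N = (\<lambda>v. {u\<in>V. adj u v})"
  define d where "d = (\<lambda>v. real (card (N v)))"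
  let ?n = "real (card V)" and ?m = "real (card H)"
  \<comment> \<open>A triangle in the link of \<open>v\<close>, given by an edge
    \<open>t - {v}\<close> and an apex \<open>u\<close>, would make \<open>u\<close> adjacent to all
    three vertices of \<open>t\<close>.\<close>
  have link: "4 * h v \<le> d v ^ 2" for v
  proof -
    let ?L = "(\<lambda>t. t - {v}) ` {t\<in>H. v \<in> t}"
    have "card ?L = card {t\<in>H. v \<in> t}" by (intro card_image) (auto simp: inj_on_def)
    moreover have "4 * real (card ?L) \<le> real (card (N v)) ^ 2"
    proof (rule mantel)
      show "finite (N v)" using V by (simp add: N_def)
    next
      fix e assume "e \<in> ?L"
      then obtain t where t: "t \<in> H" "v \<in> t" "e = t - {v}" by auto
      moreover have "finite t" using t H V by (meson finite_subset)
      ultimately show "e \<subseteq> N v \<and> card e = 2" using H[of t] by (auto simp: N_def adj_def)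
    next
      fix e u assume e: "e \<in> ?L" and u: "u \<in> N v"
      from e obtain t where t: "t \<in> H" "v \<in> t" "e = t - {v}" by auto
      show "\<exists>w\<in>e. {u, w} \<notin> ?L"
      proof (rule ccontr)
        assume "\<not> ?thesis"
        then have *: "{u, w} \<in> ?L" if "w \<in> e" for w using that by auto
        have "adj u w" if "w \<in> t" for w
        proof (cases "w = v")
          case True
          then show ?thesis using u by (simp add: N_def)
        next
          case False
          then have "{u, w} \<in> ?L" using that t * by auto
          then obtain s where s: "s \<in> H" "v \<in> s" "{u, w} = s - {v}" by auto
          moreover have "finite s" using s H V by (meson finite_subset)
          ultimately have "card {u, w} = 2" using H[of s] by simp
          then have "u \<noteq> w" by auto
          moreover have "u \<in> s" "w \<in> s" using s(3) by blast+
          ultimately show ?thesis using s(1) unfolding adj_def by blast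
        qed
        moreover have "u \<in> V" using u by (simp add: N_def)
        ultimately show False using cov'[OF t(1)] by blast
      qed
    qed
    ultimately show ?thesis by (simp add: h_def d_def)
  qed
  have "(\<Sum>v\<in>V. h v) = (\<Sum>t\<in>H. \<Sum>v\<in>t. 1)"
    using sum_sum_members[of V H "\<lambda>_. 1"] V finH H by (simp add: h_def)
  also have "\<dots> = (\<Sum>t\<in>H. 3)" using H by (intro sum.cong) auto
  finally have sumh: "(\<Sum>v\<in>V. h v) = 3 * ?m" by simp
  have "(\<Sum>v\<in>V. h v * d v) = (\<Sum>t\<in>H. \<Sum>v\<in>t. d v)"
    using sum_sum_members[of V H d] V finH H by (simp add: h_def)
  \<comment> \<open>Each vertex is adjacent to at most two of the three vertices of a
    member.\<close>
  also have "\<dots> \<le> (\<Sum>t\<in>H. 2 * ?n)"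
  proof (rule sum_mono)
    fix t assume t: "t \<in> H"
    have ft: "finite t" using t H V by (meson finite_subset)
    have "(\<Sum>v\<in>t. d v) = (\<Sum>v\<in>t. \<Sum>u\<in>{u\<in>V. adj u v}. 1)"
      by (simp add: d_def N_def)
    also have "\<dots> = (\<Sum>u\<in>V. \<Sum>v\<in>{v\<in>t. adj u v}. 1)"
      by (rule sum.swap_restrict[OF ft V])
    also have "\<dots> \<le> (\<Sum>u\<in>V. 2)"
    proof (rule sum_mono)
      fix u assume "u \<in> V"
      then obtain v where "v \<in> t" "\<not> adj u v" using cov' t by blast
      then have "{v\<in>t. adj u v} \<subseteq> t - {v}" by auto
      then have "card {v\<in>t. adj u v} \<le> card (t - {v})" using ft by (intro card_mono) auto
      then show "(\<Sum>v\<in>{v\<in>t. adj u v}. 1::real) \<le> 2" using t H \<open>v \<in> t\<close> by simp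
    qed
    finally show "(\<Sum>v\<in>t. d v) \<le> 2 * ?n" by simp
  qed
  finally have upper: "(\<Sum>v\<in>V. h v * d v) \<le> 2 * ?n * ?m" by (simp add: mult_ac)
  text \<open>The tangent of the convex function \<open>s \<mapsto> 2 s\<^sup>3\<close> at \<open>s = n / 3\<close> replaces the power mean
    inequality for \<open>s = sqrt (h v)\<close>.\<close>
  have tangent: "?n * h v - ?n ^ 3 / 27 \<le> h v * d v" for v
  proof -
    define s where "s = sqrt (h v)"
    have h: "h v = s ^ 2" "s \<ge> 0" by (simp_all add: s_def h_def)
    have "(2 * s) ^ 2 \<le> d v ^ 2" using link[of v] h by (simp add: power_mult_distrib)
    then have "2 * s \<le> d v" by (rule power2_le_imp_le) (simp add: d_def)
    then have "s ^ 2 * (2 * s) \<le> s ^ 2 * d v" by (intro mult_left_mono) auto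
    moreover have "s ^ 2 * (2 * s) = 2 * s ^ 3" by (simp add: power2_eq_square power3_eq_cube)
    ultimately have *: "2 * s ^ 3 \<le> h v * d v" using h by simp
    have "0 \<le> 2 * (s - ?n / 3) ^ 2 * (s + ?n / 6)" using h by simp
    also have "\<dots> = 2 * s ^ 3 - ?n * s ^ 2 + ?n ^ 3 / 27"
      by (simp add: power2_eq_square power3_eq_cube field_simps)
    finally have "?n * s ^ 2 - ?n ^ 3 / 27 \<le> 2 * s ^ 3" by linarith
    moreover have "?n * h v = ?n * s ^ 2" by (simp only: h(1))
    ultimately show ?thesis using * by linarith
  qed
  have "?n * (3 * ?m) - ?n * (?n ^ 3 / 27) = (\<Sum>v\<in>V. ?n * h v - ?n ^ 3 / 27)"
    unfolding sumh[symmetric] by (simp add: sum_subtractf sum_distrib_left)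
  also have "\<dots> \<le> (\<Sum>v\<in>V. h v * d v)" using tangent by (intro sum_mono) auto
  also have "\<dots> \<le> 2 * ?n * ?m" by (rule upper)
  finally have *: "0 \<le> ?n * (?n ^ 3 / 27 - ?m)" by (simp add: algebra_simps)
  show ?thesis
  proof (cases "card V = 0")
    case True
    then have "H = {}" using V H by fastforce
    then show ?thesis by simp
  next
    case False
    then have "?n > 0" by simp
    with * show ?thesis by (simp add: zero_le_mult_iff)
  qed
qed

section \<open>Upper bounds\<close>

lemma card_eq_4_elim:
  assumes "card S = 4"
  obtains a b c d where "S = {a,b,c,d}" "distinct [a,b,c,d]"
proof -
  have "card S = Suc 3" using assms by simp
  then obtain a B where B: "S = insert a B" "a \<notin> B" "card B = 3" by (metis card_Suc_eq)
  then obtain b c d where "B = {b,c,d}" "distinct [b,c,d]" by (auto simp: card_3_iff)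
  with B show ?thesis using that[of a b c d] by simp
qed

section \<open>Complexes free of F1, F2 or F3\<close>

locale vertex_complex =
  fixes K :: "'a hgraph" and n :: nat
  assumes complex: "abstract_simplicial_complex K" and card_verts: "card (verts K) = n"
begin

abbreviation "V \<equiv> verts K"
abbreviation "E \<equiv> edges K"

lemma finite_verts: "finite V"
  and face_subset: "e \<in> E \<Longrightarrow> e \<subseteq> V"
  and face_down: "e \<in> E \<Longrightarrow> s \<subseteq> e \<Longrightarrow> s \<in> E"
  using complex by (auto simp: abstract_simplicial_complex_def hypergraph_def)

lemma finite_face: "e \<in> E \<Longrightarrow> finite e"
  using finite_verts face_subset finite_subset by blast

lemma finite_faces: "finite E"
  using finite_verts face_subset by (meson PowI finite_Pow_iff finite_subset subsetI)

lemma card_faces_le: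
  "card E \<le> (n + 1) ^ k + card {e\<in>E. card e > k}"
proof -
  have "E = {e\<in>E. card e \<le> k} \<union> {e\<in>E. card e > k}" by auto
  then have "card E \<le> card {e\<in>E. card e \<le> k} + card {e\<in>E. card e > k}"
    by (metis card_Un_le)
  also have "card {e\<in>E. card e \<le> k} \<le> card {S. S \<subseteq> V \<and> card S \<le> k}"
    using finite_verts face_subset by (intro card_mono) auto
  also have "\<dots> \<le> (n + 1) ^ k"
    using card_subsets_le[OF finite_verts, of k] card_verts by simp
  finally show ?thesis by simp
qed

lemma card_faces_le_triples:
  assumes "card {e\<in>E. card e > 2 \<and> e \<notin> H} \<le> c" "H \<subseteq> E"
  shows "card E \<le> (n + 1) ^ 2 + c + card H"
proof -
  have fin: "finite H" using assms finite_faces finite_subset by blast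
  have "{e\<in>E. card e > 2} \<subseteq> {e\<in>E. card e > 2 \<and> e \<notin> H} \<union> H" by auto
  then have "card {e\<in>E. card e > 2} \<le> card ({e\<in>E. card e > 2 \<and> e \<notin> H} \<union> H)"
    using finite_faces fin by (intro card_mono) auto
  also have "\<dots> \<le> c + card H" using card_Un_le assms(1) by (meson add_right_mono order_trans)
  finally show ?thesis using card_faces_le[of 2] by linarith
qed

text \<open>The constant 432 is 27 times 16: each of the at most n^2 low pairs accounts for at most
  16 faces, the subsets of a 4-set. The triples without a low pair satisfy the covering hypothesis
  of \<open>card_triples_no_covered_vertex\<close>.\<close>

lemma F1_free_bound:
  assumes free: "free_of K F1"
  shows "27 * real (card E) \<le> 27 * (real n + 1) ^ 2 + 432 * real n ^ 2 + real n ^ 3"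
proof -
  have key: "z \<in> {a,b,c,d}"
    if "{a,b,c} \<in> E" "{a,d} \<in> E" "{b,d} \<in> E" "{c,d} \<in> E" "{a,d,z} \<in> E" "distinct [a,b,c,d]"
    for a b c d z
  proof (rule ccontr)
    assume "\<not> ?thesis"
    \<comment> \<open>A copy of \<open>F1\<close>: the two triangles share \<open>a\<close>, and
      \<open>d\<close>, in the role of vertex 3, is joined to \<open>b\<close> and
      \<open>c\<close>.\<close>
    then have "distinct [a,z,d,b,c]" "{a,z,d} \<in> E" "{a,b,c} \<in> E" "{d,b} \<in> E" "{d,c} \<in> E"
      using that by (auto simp: insert_commute)
    then show False using free free_of_F1_iff[OF complex] by blast
  qed
  define low where "low = (\<lambda>(x, y). \<exists>B. finite B \<and> card B \<le> 4 \<and>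
    (\<forall>S\<in>E. x \<in> S \<and> y \<in> S \<longrightarrow> card (S - B) \<le> 0))"
  have lowI: "low (a, d)"
    if "{a,b,c} \<in> E" "{a,d} \<in> E" "{b,d} \<in> E" "{c,d} \<in> E" "distinct [a,b,c,d]" for a b c d
  proof -
    have "card (S - {a,b,c,d}) \<le> 0" if "S \<in> E" "a \<in> S" "d \<in> S" for S
    proof -
      have "z \<in> {a,b,c,d}" if "z \<in> S" for z
        using key[of a b c d z] \<open>{a,b,c} \<in> E\<close> \<open>{a,d} \<in> E\<close> \<open>{b,d} \<in> E\<close> \<open>{c,d} \<in> E\<close>
          \<open>distinct [a,b,c,d]\<close> face_down[of S "{a,d,z}"] \<open>S \<in> E\<close> \<open>a \<in> S\<close> \<open>d \<in> S\<close> that by simp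
      then have "S - {a,b,c,d} = {}" by blast
      then show ?thesis by (simp only: card.empty)
    qed
    moreover have "finite {a,b,c,d}" "card {a,b,c,d} \<le> 4" by (simp_all add: card_insert_if)
    ultimately show ?thesis unfolding low_def prod.case by blast
  qed
  define H where "H = {t\<in>E. card t = 3 \<and> (\<forall>x\<in>t. \<forall>y\<in>t. x \<noteq> y \<longrightarrow> \<not> low (x, y))}"
  let ?R = "{e\<in>E. card e > 2 \<and> e \<notin> H}"
  have "card ?R \<le> card (V \<times> V) * (2 ^ 4 * (card V + 1) ^ 0)"
  proof (rule card_dominated_le[where P = "\<lambda>(x, y) S. x \<in> S \<and> y \<in> S"])
    fix T assume T: "T \<in> ?R"
    have "\<exists>x y. x \<in> T \<and> y \<in> T \<and> low (x, y)"
    proof (cases "card T = 3")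
      case True
      then show ?thesis using T unfolding H_def by blast
    next
      case False
      \<comment> \<open>Any four vertices of a face form a triple with a vertex joined to all of it,
        so a large face contains a low pair.\<close>
      then have "card T \<ge> 4" using T by auto
      then obtain S where "S \<subseteq> T" "card S = 4" by (metis obtain_subset_with_card_n)
      then obtain a b c d where S: "S = {a,b,c,d}" "distinct [a,b,c,d]"
        by (metis card_eq_4_elim)
      have "{a,b,c} \<in> E" "{a,d} \<in> E" "{b,d} \<in> E" "{c,d} \<in> E"
        using S \<open>S \<subseteq> T\<close> T by (auto intro: face_down[of T])
      then have "low (a, d)" using S(2) by (rule lowI)
      then show ?thesis using S \<open>S \<subseteq> T\<close> by blast
    qed
    then obtain x y where xy: "x \<in> T" "y \<in> T" "low (x, y)" by blast
    moreover have "(x, y) \<in> V \<times> V" using xy T face_subset by blast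
    ultimately show "\<exists>i\<in>V \<times> V. (case i of (x, y) \<Rightarrow> \<lambda>S. x \<in> S \<and> y \<in> S) T \<and>
       (\<exists>B. finite B \<and> card B \<le> 4 \<and>
         (\<forall>S\<in>?R. (case i of (x, y) \<Rightarrow> \<lambda>S. x \<in> S \<and> y \<in> S) S \<longrightarrow> card (S - B) \<le> 0))"
      unfolding low_def by (intro bexI[of _ "(x, y)"]) auto
  qed (use finite_verts face_subset in auto)
  then have "card ?R \<le> 16 * n ^ 2"
    by (simp add: card_verts card_cartesian_product power2_eq_square)
  then have "card E \<le> (n + 1) ^ 2 + 16 * n ^ 2 + card H"
    by (rule card_faces_le_triples) (auto simp: H_def)
  then have "real (card E) \<le> real ((n + 1) ^ 2 + 16 * n ^ 2 + card H)"
    by (rule of_nat_mono)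
  moreover have "27 * real (card H) \<le> real (card V) ^ 3"
  proof (rule card_triples_no_covered_vertex[OF finite_verts])
    fix t u assume t: "t \<in> H" and u: "u \<in> V"
    show "\<exists>v\<in>t. \<not> (u \<noteq> v \<and> (\<exists>s\<in>H. u \<in> s \<and> v \<in> s))"
    proof (rule ccontr)
      assume "\<not> ?thesis"
      then have *: "u \<noteq> v \<and> (\<exists>s\<in>H. u \<in> s \<and> v \<in> s)" if "v \<in> t" for v using that by blast
      obtain a b c where abc: "t = {a,b,c}" "distinct [a,b,c]"
        using t by (auto simp: H_def card_3_iff)
      have edge: "{v, u} \<in> E" if v: "v \<in> t" for v
      proof -
        obtain s where "s \<in> H" "u \<in> s" "v \<in> s" using *[OF v] by blast
        then show ?thesis using face_down[of s "{v, u}"] by (auto simp: H_def)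
      qed
      have "distinct [a,b,c,u]" using abc * by auto
      moreover have "{a,b,c} \<in> E" using t abc by (simp add: H_def)
      \<comment> \<open>A vertex \<open>u\<close> covering all of \<open>t\<close> makes the pair of
        \<open>a\<close> and \<open>u\<close> low, although this pair lies in a member of
        \<open>H\<close>.\<close>
      ultimately have "low (a, u)" using abc edge lowI[of a b c u] by blast
      moreover obtain s where "s \<in> H" "u \<in> s" "a \<in> s" "u \<noteq> a" using * abc by blast
      ultimately show False by (auto simp: H_def)
    qed
  qed (auto simp: H_def dest: face_subset)
  ultimately show ?thesis by (simp add: card_verts algebra_simps)
qed

text \<open>The scheme for \<open>F1\<close> with low vertices in place of low pairs. A face through
  a low vertex is given by its trace on a 4-set and at most one further vertex, hence the bound 16
  (n + 1) per low vertex.\<close>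

lemma F2_free_bound:
  assumes free: "free_of K F2"
  shows "27 * real (card E) \<le> 27 * (real n + 1) ^ 2 + 432 * real n * (real n + 1) + real n ^ 3"
proof -
  define low where "low = (\<lambda>v. \<exists>B. finite B \<and> card B \<le> 4 \<and>
    (\<forall>S\<in>E. v \<in> S \<longrightarrow> card (S - B) \<le> 1))"
  have lowI: "low v"
    if abc: "{a,b,c} \<in> E" "{v,a} \<in> E" "{v,b} \<in> E" "{v,c} \<in> E" "distinct [a,b,c,v]" for a b c v
  proof -
    have "card (S - {a,b,c,v}) \<le> 1" if S: "S \<in> E" "v \<in> S" for S
    proof (rule ccontr)
      assume "\<not> ?thesis"
      then have "card (S - {a,b,c,v}) \<ge> 2" by simp
      then obtain P where "P \<subseteq> S - {a,b,c,v}" "card P = 2" by (metis obtain_subset_with_card_n)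
      then obtain y z where yz: "{y, z} \<subseteq> S - {a,b,c,v}" "y \<noteq> z" by (metis card_2_iff)
      \<comment> \<open>The triples \<open>{v,y,z}\<close> and \<open>{a,b,c}\<close> together with
        the edges from \<open>v\<close> to \<open>a\<close>, \<open>b\<close>, \<open>c\<close> form
        a copy of \<open>F2\<close>.\<close>
      then have "{v,y,z} \<in> E" using face_down[OF S(1), of "{v,y,z}"] S(2) by blast
      moreover have "distinct [v,y,z,a,b,c]" using yz abc(5) by simp blast
      ultimately show False using free free_of_F2_iff[OF complex] abc by blast
    qed
    moreover have "finite {a,b,c,v}" "card {a,b,c,v} \<le> 4" by (simp_all add: card_insert_if)
    ultimately show ?thesis unfolding low_def by blast
  qed
  define H where "H = {t\<in>E. card t = 3 \<and> (\<forall>x\<in>t. \<not> low x)}"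
  let ?R = "{e\<in>E. card e > 2 \<and> e \<notin> H}"
  have "card ?R \<le> card V * (2 ^ 4 * (card V + 1) ^ 1)"
  proof (rule card_dominated_le[where P = "\<lambda>x S. x \<in> S"])
    fix T assume T: "T \<in> ?R"
    have "\<exists>x. x \<in> T \<and> low x"
    proof (cases "card T = 3")
      case True
      then show ?thesis using T unfolding H_def by blast
    next
      case False
      then have "card T \<ge> 4" using T by auto
      then obtain S where "S \<subseteq> T" "card S = 4" by (metis obtain_subset_with_card_n)
      then obtain a b c d where S: "S = {a,b,c,d}" "distinct [a,b,c,d]"
        by (metis card_eq_4_elim)
      have "{a,b,c} \<in> E" "{d,a} \<in> E" "{d,b} \<in> E" "{d,c} \<in> E"
        using S \<open>S \<subseteq> T\<close> T by (auto intro: face_down[of T])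
      then have "low d" using S(2) by (rule lowI)
      then show ?thesis using S \<open>S \<subseteq> T\<close> by blast
    qed
    then obtain x where "x \<in> T" "low x" by blast
    moreover have "x \<in> V" using \<open>x \<in> T\<close> T face_subset by blast
    ultimately show "\<exists>i\<in>V. i \<in> T \<and>
       (\<exists>B. finite B \<and> card B \<le> 4 \<and> (\<forall>S\<in>?R. i \<in> S \<longrightarrow> card (S - B) \<le> 1))"
      unfolding low_def by (intro bexI[of _ x]) auto
  qed (use finite_verts face_subset in auto)
  then have "card ?R \<le> 16 * n * (n + 1)" by (simp add: card_verts algebra_simps)
  then have "card E \<le> (n + 1) ^ 2 + 16 * n * (n + 1) + card H"
    by (rule card_faces_le_triples) (auto simp: H_def)
  then have "real (card E) \<le> real ((n + 1) ^ 2 + 16 * n * (n + 1) + card H)"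
    by (rule of_nat_mono)
  moreover have "27 * real (card H) \<le> real (card V) ^ 3"
  proof (rule card_triples_no_covered_vertex[OF finite_verts])
    fix t u assume t: "t \<in> H" and u: "u \<in> V"
    show "\<exists>v\<in>t. \<not> (u \<noteq> v \<and> (\<exists>s\<in>H. u \<in> s \<and> v \<in> s))"
    proof (rule ccontr)
      assume "\<not> ?thesis"
      then have *: "u \<noteq> v \<and> (\<exists>s\<in>H. u \<in> s \<and> v \<in> s)" if "v \<in> t" for v using that by blast
      obtain a b c where abc: "t = {a,b,c}" "distinct [a,b,c]"
        using t by (auto simp: H_def card_3_iff)
      have edge: "{u, v} \<in> E" if v: "v \<in> t" for v
      proof -
        obtain s where "s \<in> H" "u \<in> s" "v \<in> s" using *[OF v] by blast
        then show ?thesis using face_down[of s "{u, v}"] by (auto simp: H_def)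
      qed
      have "distinct [a,b,c,u]" using abc * by auto
      moreover have "{a,b,c} \<in> E" using t abc by (simp add: H_def)
      ultimately have "low u" using abc edge lowI[of a b c u] by blast
      moreover obtain s where "s \<in> H" "u \<in> s" using * abc by blast
      ultimately show False by (auto simp: H_def)
    qed
  qed (auto simp: H_def dest: face_subset)
  ultimately show ?thesis by (simp add: card_verts algebra_simps)
qed

text \<open>A four-vertex face \<open>abcd\<close> supplies all cross edges between
  \<open>ab\<close> and \<open>cd\<close>, so triples \<open>abe\<close> and \<open>cdf\<close> with
  distinct \<open>e\<close>, \<open>f\<close> outside it would complete a copy of \<open>F3\<close>.
  Hence either an outside \<open>e\<close> exists and all faces through \<open>cd\<close> lie in
  \<open>abcde\<close>, or no face through \<open>ab\<close> leaves \<open>abcd\<close>. Some pair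
  in the face thus lies in at most 32 faces.\<close>

lemma F3_free_bound:
  assumes free: "free_of K F3"
  shows "card E \<le> (n + 1) ^ 3 + 32 * n ^ 2"
proof -
  have "card {e\<in>E. card e > 3} \<le> card (V \<times> V) * (2 ^ 5 * (card V + 1) ^ 0)"
  proof (rule card_dominated_le[where P = "\<lambda>(x, y) S. x \<in> S \<and> y \<in> S"])
    fix T assume T: "T \<in> {e\<in>E. card e > 3}"
    then have "card T \<ge> 4" by auto
    then obtain S where "S \<subseteq> T" "card S = 4" by (metis obtain_subset_with_card_n)
    then obtain a b c d where S: "S = {a,b,c,d}" "distinct [a,b,c,d]"
      by (metis card_eq_4_elim)
    have *: "e = f" if "{a,b,e} \<in> E" "{c,d,f} \<in> E" "e \<notin> S" "f \<notin> S" for e f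
    proof (rule ccontr)
      assume "e \<noteq> f"
      then have "distinct [a,b,e,c,d,f]" using S that by auto
      moreover have "{a,c} \<in> E" "{a,d} \<in> E" "{b,c} \<in> E" "{b,d} \<in> E"
        using S \<open>S \<subseteq> T\<close> T by (auto intro: face_down[of T])
      ultimately show False using free free_of_F3_iff[OF complex] that by blast
    qed
    have "\<exists>x y B. x \<in> T \<and> y \<in> T \<and> finite B \<and> card B \<le> 5 \<and> (\<forall>S\<in>E. x \<in> S \<and> y \<in> S \<longrightarrow> S \<subseteq> B)"
    proof (cases "\<exists>e. {a,b,e} \<in> E \<and> e \<notin> S")
      case True
      then obtain e where e: "{a,b,e} \<in> E" "e \<notin> S" by blast
      have "R \<subseteq> insert e S" if "R \<in> E" "c \<in> R" "d \<in> R" for R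
      proof
        fix f assume "f \<in> R"
        then have "{c,d,f} \<in> E" using that face_down[of R "{c,d,f}"] by simp
        then show "f \<in> insert e S" using * e by blast
      qed
      moreover have "card (insert e S) \<le> 5" "finite (insert e S)"
        using S by (simp_all add: card_insert_if)
      ultimately show ?thesis
        using S \<open>S \<subseteq> T\<close> by (intro exI[of _ c] exI[of _ d] exI[of _ "insert e S"]) auto
    next
      case False
      have "R \<subseteq> S" if "R \<in> E" "a \<in> R" "b \<in> R" for R
      proof
        fix f assume "f \<in> R"
        then have "{a,b,f} \<in> E" using that face_down[of R "{a,b,f}"] by simp
        then show "f \<in> S" using False by blast
      qed
      moreover have "card S \<le> 5" "finite S" using S by (simp_all add: card_insert_if)
      ultimately show ?thesis
        using S \<open>S \<subseteq> T\<close> by (intro exI[of _ a] exI[of _ b] exI[of _ S]) auto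
    qed
    then obtain x y B where xy: "x \<in> T" "y \<in> T" "finite B" "card B \<le> 5"
      and B: "\<forall>S\<in>E. x \<in> S \<and> y \<in> S \<longrightarrow> S \<subseteq> B" by blast
    have "(x, y) \<in> V \<times> V" using xy T face_subset by blast
    moreover have "\<forall>S\<in>E. x \<in> S \<and> y \<in> S \<longrightarrow> card (S - B) \<le> 0"
    proof (intro ballI impI)
      fix R assume "R \<in> E" "x \<in> R \<and> y \<in> R"
      then have "R - B = {}" using B by blast
      then show "card (R - B) \<le> 0" by (simp only: card.empty)
    qed
    then have "\<exists>B. finite B \<and> card B \<le> 5 \<and> (\<forall>S\<in>E. x \<in> S \<and> y \<in> S \<longrightarrow> card (S - B) \<le> 0)"
      using xy by blast
    ultimately show "\<exists>i\<in>V \<times> V. (case i of (x, y) \<Rightarrow> \<lambda>S. x \<in> S \<and> y \<in> S) T \<and>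
       (\<exists>B. finite B \<and> card B \<le> 5 \<and> (\<forall>S\<in>{e\<in>E. card e > 3}.
         (case i of (x, y) \<Rightarrow> \<lambda>S. x \<in> S \<and> y \<in> S) S \<longrightarrow> card (S - B) \<le> 0))"
      using xy by (intro bexI[of _ "(x, y)"]) auto
  qed (use finite_verts face_subset in auto)
  also have "\<dots> = 32 * n ^ 2"
    by (simp add: card_verts card_cartesian_product power2_eq_square)
  finally show ?thesis using card_faces_le[of 3] by linarith
qed

end

section \<open>Double counting for C4 and K(2,2,2)\<close>

text \<open>Cauchy-Schwarz applied to the degrees on the \<open>Y\<close> side; a squared degree
  counts the ordered pairs of neighbours, and exchanging the sums yields codegrees.\<close>

lemma card_square_le_codegrees:
  assumes X: "finite X" and Y: "finite Y" and R: "R \<subseteq> X \<times> Y"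
  shows "real (card R) ^ 2 \<le> real (card Y) *
    (\<Sum>x\<in>X. \<Sum>x'\<in>X. real (card {y\<in>Y. (x, y) \<in> R \<and> (x', y) \<in> R}))"
proof -
  define N where "N = (\<lambda>y. {x\<in>X. (x, y) \<in> R})"
  have finN: "finite (N y)" for y using X by (simp add: N_def)
  have "R\<inverse> = (SIGMA y:Y. N y)" using R by (auto simp: N_def)
  then have "card R = card (SIGMA y:Y. N y)" by (metis card_inverse)
  then have "real (card R) = (\<Sum>y\<in>Y. real (card (N y)))"
    using Y finN by (simp add: card_SigmaI)
  then have "real (card R) ^ 2 \<le> (\<Sum>y\<in>Y. real (card (N y)) ^ 2) * real (card Y)"
    by (simp add: sum_squared_le_sum_of_squares)
  also have "(\<Sum>y\<in>Y. real (card (N y)) ^ 2) = (\<Sum>y\<in>Y. \<Sum>p\<in>{p\<in>X \<times> X. fst p \<in> N y \<and> snd p \<in> N y}. 1)"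
  proof (intro sum.cong refl)
    fix y
    have "{p\<in>X \<times> X. fst p \<in> N y \<and> snd p \<in> N y} = N y \<times> N y" by (auto simp: N_def)
    then show "real (card (N y)) ^ 2 = (\<Sum>p\<in>{p\<in>X \<times> X. fst p \<in> N y \<and> snd p \<in> N y}. 1)"
      by (simp add: card_cartesian_product power2_eq_square)
  qed
  also have "\<dots> = (\<Sum>p\<in>X \<times> X. \<Sum>y\<in>{y\<in>Y. fst p \<in> N y \<and> snd p \<in> N y}. 1)"
    using X Y by (intro sum.swap_restrict) auto
  also have "\<dots> = (\<Sum>x\<in>X. \<Sum>x'\<in>X. real (card {y\<in>Y. x \<in> N y \<and> x' \<in> N y}))"
    by (simp add: sum.cartesian_product case_prod_beta)
  also have "\<dots> = (\<Sum>x\<in>X. \<Sum>x'\<in>X. real (card {y\<in>Y. (x, y) \<in> R \<and> (x', y) \<in> R}))"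
    by (intro sum.cong refl arg_cong[of _ _ real] arg_cong[of _ _ card]) (auto simp: N_def)
  finally show ?thesis by (simp add: mult.commute)
qed

lemma card_square_le_of_codegree_le:
  assumes X: "finite X" and Y: "finite Y" and R: "R \<subseteq> X \<times> Y"
    and k: "\<And>x x'. x \<in> X \<Longrightarrow> x' \<in> X \<Longrightarrow> x \<noteq> x' \<Longrightarrow>
      real (card {y\<in>Y. (x, y) \<in> R \<and> (x', y) \<in> R}) \<le> k" "k \<ge> 0"
  shows "real (card R) ^ 2 \<le> real (card Y) * (real (card X) ^ 2 * k + real (card R))"
proof -
  have "(\<Sum>x\<in>X. \<Sum>x'\<in>X. real (card {y\<in>Y. (x, y) \<in> R \<and> (x', y) \<in> R})) \<le>
      (\<Sum>x\<in>X. \<Sum>x'\<in>X. k + (if x' = x then real (card {y\<in>Y. (x, y) \<in> R}) else 0))"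
    using k by (intro sum_mono) auto
  also have "\<dots> = (\<Sum>x\<in>X. real (card X) * k + real (card {y\<in>Y. (x, y) \<in> R}))"
    using X by (intro sum.cong refl) (simp add: sum.distrib)
  also have "\<dots> = real (card X) ^ 2 * k + (\<Sum>x\<in>X. real (card {y\<in>Y. (x, y) \<in> R}))"
    by (simp add: sum.distrib power2_eq_square)
  also have "(\<Sum>x\<in>X. real (card {y\<in>Y. (x, y) \<in> R})) = real (card R)"
  proof -
    have "R = (SIGMA x:X. {y\<in>Y. (x, y) \<in> R})" using R by auto
    then have "card R = card (SIGMA x:X. {y\<in>Y. (x, y) \<in> R})" by simp
    also have "\<dots> = (\<Sum>x\<in>X. card {y\<in>Y. (x, y) \<in> R})"
      using X Y by (intro card_SigmaI) auto
    finally have "card R = (\<Sum>x\<in>X. card {y\<in>Y. (x, y) \<in> R})" .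
    then show ?thesis by simp
  qed
  finally show ?thesis
    using card_square_le_codegrees[OF X Y R] by (meson mult_left_mono of_nat_0_le_iff order_trans)
qed

text \<open>The difference of the two sides factors as \<open>(m - 2 * c) * (m + c)\<close>.\<close>

lemma quadratic_le_imp_le:
  fixes m c :: real
  assumes "m ^ 2 \<le> 2 * c ^ 2 + c * m" "c \<ge> 0"
  shows "m \<le> 2 * c"
proof (rule ccontr)
  assume "\<not> ?thesis"
  then have "0 < (m - 2 * c) * (m + c)" using assms(2) by (intro mult_pos_pos) auto
  with assms(1) show False by (simp add: power2_eq_square algebra_simps)
qed

text \<open>The Kovari-Sos-Turan argument: two distinct vertices have at most one common neighbour.
  \<open>R\<close> is read as a bipartite graph between two copies of \<open>V\<close>.\<close>

lemma card_C4_free_le: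
  assumes V: "finite V" and R: "R \<subseteq> V \<times> V"
    and free: "\<And>x x' y y'. x \<noteq> x' \<Longrightarrow> y \<noteq> y' \<Longrightarrow> (x, y) \<in> R \<Longrightarrow> (x, y') \<in> R \<Longrightarrow>
      (x', y) \<in> R \<Longrightarrow> (x', y') \<in> R \<Longrightarrow> False"
  shows "real (card R) \<le> 2 * real (card V) powr (3/2)"
proof (cases "card V = 0")
  case True
  then show ?thesis using V R by (simp add: subset_empty)
next
  case False
  let ?n = "real (card V)" and ?c = "real (card V) powr (3/2)"
  have n: "?n \<ge> 1" using False by linarith
  have "real (card R) ^ 2 \<le> ?n * (?n ^ 2 * 1 + real (card R))"
  proof (rule card_square_le_of_codegree_le[OF V V R])
    fix x x' :: 'a assume "x \<noteq> x'"
    have "card {y\<in>V. (x, y) \<in> R \<and> (x', y) \<in> R} \<le> Suc 0"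
      using V free[OF \<open>x \<noteq> x'\<close>] by (subst card_le_Suc0_iff_eq) auto
    then show "real (card {y\<in>V. (x, y) \<in> R \<and> (x', y) \<in> R}) \<le> 1" by simp
  qed auto
  also have "\<dots> = ?c ^ 2 + ?n * real (card R)"
  proof -
    have "?c ^ 2 = ?n powr 3" by (simp add: power2_eq_square flip: powr_add)
    also have "\<dots> = ?n ^ 3" using n by (simp add: powr_numeral)
    finally show ?thesis by (simp add: power2_eq_square power3_eq_cube algebra_simps)
  qed
  also have "\<dots> \<le> 2 * ?c ^ 2 + ?c * real (card R)"
    using powr_mono[of 1 "3/2" ?n] n by (intro add_mono mult_right_mono) auto
  finally show ?thesis by (rule quadratic_le_imp_le) simp
qed

text \<open>The case \<open>r = 3\<close>, \<open>t = 2\<close> of Erdos's bound for complete \<open>r\<close>-partite hypergraphs.\<close>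
lemma card_K222_free_le:
  assumes V: "finite V" and T: "T \<subseteq> V \<times> V \<times> V"
    and free: "\<And>x x' y y' z z'. x \<noteq> x' \<Longrightarrow> y \<noteq> y' \<Longrightarrow> z \<noteq> z' \<Longrightarrow>
      {x, x'} \<times> {y, y'} \<times> {z, z'} \<subseteq> T \<Longrightarrow> False"
  shows "real (card T) \<le> 2 * real (card V) powr (11/4)"
proof (cases "card V = 0")
  case True
  then show ?thesis using V T by (simp add: subset_empty)
next
  case False
  let ?n = "real (card V)" and ?c = "real (card V) powr (11/4)"
  have n: "?n \<ge> 1" using False by linarith
  \<comment> \<open>\<open>T\<close> is read as a bipartite graph between vertices and pairs. The
    common link of two distinct vertices is C4-free, so the previous lemma bounds the
    codegrees.\<close>
  have "real (card T) ^ 2 \<le> real (card (V \<times> V)) * (?n ^ 2 * (2 * ?n powr (3/2)) + real (card T))"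
  proof (rule card_square_le_of_codegree_le[OF V _ T])
    fix x x' :: 'a assume "x \<noteq> x'"
    show "real (card {p\<in>V \<times> V. (x, p) \<in> T \<and> (x', p) \<in> T}) \<le> 2 * ?n powr (3/2)"
    proof (rule card_C4_free_le[OF V])
      fix y y' z z' assume "y \<noteq> y'" "z \<noteq> z'"
        "(y, z) \<in> {p\<in>V \<times> V. (x, p) \<in> T \<and> (x', p) \<in> T}"
        "(y, z') \<in> {p\<in>V \<times> V. (x, p) \<in> T \<and> (x', p) \<in> T}"
        "(y', z) \<in> {p\<in>V \<times> V. (x, p) \<in> T \<and> (x', p) \<in> T}"
        "(y', z') \<in> {p\<in>V \<times> V. (x, p) \<in> T \<and> (x', p) \<in> T}"
      then show False using \<open>x \<noteq> x'\<close> by (intro free[of x x' y y' z z']) auto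
    qed auto
  qed (use V in auto)
  also have "\<dots> = 2 * ?c ^ 2 + ?n ^ 2 * real (card T)"
  proof -
    have "?c ^ 2 = ?n powr (2 + 2 + 3/2)" by (simp add: power2_eq_square flip: powr_add)
    also have "\<dots> = ?n ^ 2 * ?n ^ 2 * ?n powr (3/2)" using n by (simp only: powr_add powr_numeral)
    finally show ?thesis by (simp add: card_cartesian_product power2_eq_square algebra_simps)
  qed
  also have "\<dots> \<le> 2 * ?c ^ 2 + ?c * real (card T)"
    using powr_mono[of 2 "11/4" ?n] n by (intro add_mono mult_right_mono) (auto simp: powr_numeral)
  finally show ?thesis by (rule quadratic_le_imp_le) simp
qed

section \<open>Complexes free of F4\<close>

context vertex_complex
begin

text \<open>\<open>F4\<close> consists of two opposite triangles and all edges of the octahedron, so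
  it is contained in the complex generated by the eight triples of a K(2,2,2).\<close>

lemma F4_free_triples:
  assumes free: "free_of K F4"
  shows "real (card {(x, y, z). distinct [x, y, z] \<and> {x, y, z} \<in> E}) \<le> 2 * real n powr (11/4)"
proof -
  let ?T = "{(x, y, z). distinct [x, y, z] \<and> {x, y, z} \<in> E}"
  have "real (card ?T) \<le> 2 * real (card V) powr (11/4)"
  proof (rule card_K222_free_le[OF finite_verts])
    show "?T \<subseteq> V \<times> V \<times> V" using face_subset by auto
  next
    fix x x' y y' z z'
    assume *: "x \<noteq> x'" "y \<noteq> y'" "z \<noteq> z'" "{x, x'} \<times> {y, y'} \<times> {z, z'} \<subseteq> ?T"
    have faces: "{x,y,z} \<in> E" "{x',y',z'} \<in> E" "{x,y,z'} \<in> E" "{x,y',z} \<in> E" "{x',y,z} \<in> E"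
        "{x,y',z'} \<in> E" "{x',y,z'} \<in> E" "{x',y',z} \<in> E"
      and "distinct [x,y,z]" "distinct [x',y',z']" "distinct [x,y,z']" "distinct [x,y',z]"
        "distinct [x',y,z]"
      using *(4) by auto
    \<comment> \<open>The nonadjacent pairs of \<open>F4\<close> are 1 and 5, 2 and 6, 3 and 4,
      which fixes the order of the primed vertices.\<close>
    then have "distinct [x,y,z,z',x',y']" using *(1-3) by auto
    moreover have "{z',x',y'} \<in> E" using faces(2) by (simp add: insert_commute)
    moreover have "{x,z'} \<in> E" "{x,y'} \<in> E" "{y,z'} \<in> E" "{y,x'} \<in> E" "{z,x'} \<in> E" "{z,y'} \<in> E"
      using face_down[OF faces(3), of "{x,z'}"] face_down[OF faces(4), of "{x,y'}"]
        face_down[OF faces(3), of "{y,z'}"] face_down[OF faces(5), of "{y,x'}"]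
        face_down[OF faces(5), of "{z,x'}"] face_down[OF faces(4), of "{z,y'}"] by simp_all
    ultimately show False using free free_of_F4_iff[OF complex] faces(1) by blast
  qed
  then show ?thesis by (simp add: card_verts)
qed

text \<open>A four-vertex face is a triple with one more vertex; the factor \<open>n\<close> for
  this vertex raises the exponent from 11/4 to 15/4.\<close>

lemma F4_free_card4:
  assumes free: "free_of K F4"
  shows "real (card {e\<in>E. card e = 4}) \<le> real n * (2 * real n powr (11/4))"
proof -
  let ?T = "{(x, y, z). distinct [x, y, z] \<and> {x, y, z} \<in> E}"
  have "?T \<subseteq> V \<times> V \<times> V" using face_subset by auto
  then have fin: "finite ?T" using finite_verts by (meson finite_SigmaI finite_subset)
  have "{e\<in>E. card e = 4} \<subseteq> (\<lambda>(v, x, y, z). {v, x, y, z}) ` (V \<times> ?T)"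
  proof
    fix e assume e: "e \<in> {e\<in>E. card e = 4}"
    then obtain v x y z where vxyz: "e = {v,x,y,z}" "distinct [v,x,y,z]" by (auto elim: card_eq_4_elim)
    have "{x,y,z} \<in> E" using e vxyz face_down[of e "{x,y,z}"] by auto
    moreover have "v \<in> V" using e vxyz face_subset by auto
    ultimately show "e \<in> (\<lambda>(v, x, y, z). {v, x, y, z}) ` (V \<times> ?T)"
      using vxyz by (intro image_eqI[of _ _ "(v, x, y, z)"]) auto
  qed
  then have "card {e\<in>E. card e = 4} \<le> card ((\<lambda>(v, x, y, z). {v, x, y, z}) ` (V \<times> ?T))"
    using fin finite_verts by (intro card_mono finite_imageI finite_cartesian_product)
  also have "\<dots> \<le> card (V \<times> ?T)"
    using fin finite_verts by (intro card_image_le finite_cartesian_product)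
  also have "\<dots> = n * card ?T" by (simp add: card_cartesian_product card_verts)
  finally have "real (card {e\<in>E. card e = 4}) \<le> real (n * card ?T)"
    by (rule of_nat_mono)
  also have "\<dots> = real n * real (card ?T)" by (rule of_nat_mult)
  also have "\<dots> \<le> real n * (2 * real n powr (11/4))"
    using F4_free_triples[OF free] by (intro mult_left_mono) auto
  finally show ?thesis .
qed

lemma F4_free_card_le5:
  assumes free: "free_of K F4" and e: "e \<in> E"
  shows "card e \<le> 5"
proof (rule ccontr)
  assume "\<not> ?thesis"
  then have "card e \<ge> 6" by simp
  then obtain S where S: "S \<subseteq> e" "card S = 6" by (metis obtain_subset_with_card_n)
  then have "card S = Suc (Suc 4)" by simp
  then obtain a A where A: "S = insert a A" "a \<notin> A" "card A = Suc 4" by (metis card_Suc_eq)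
  then obtain b B where B: "A = insert b B" "b \<notin> B" "card B = 4" by (metis card_Suc_eq)
  then obtain c d f g where "B = {c,d,f,g}" "distinct [c,d,f,g]" by (metis card_eq_4_elim)
  with A B have "S = {a,b,c,d,f,g}" "distinct [a,b,c,d,f,g]" by auto
  then have "distinct [a,b,c,d,f,g]" "{a,b,c} \<in> E" "{d,f,g} \<in> E" "{a,d} \<in> E" "{a,g} \<in> E"
      "{b,d} \<in> E" "{b,f} \<in> E" "{c,f} \<in> E" "{c,g} \<in> E"
    using S by (auto intro: face_down[OF e])
  then show False using free free_of_F4_iff[OF complex] by blast
qed

text \<open>Deleting a chosen vertex is injective on five-vertex faces, because two of them cannot
  share a four-vertex subface.\<close>

lemma F4_free_card5:
  assumes free: "free_of K F4"
  shows "card {e\<in>E. card e = 5} \<le> card {e\<in>E. card e = 4}"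
proof -
  define g where "g = (\<lambda>e::'a set. e - {SOME x. x \<in> e})"
  have g: "\<exists>x\<in>e. g e = e - {x}" if "card e = 5" for e :: "'a set"
  proof -
    have "e \<noteq> {}" using that by auto
    then show ?thesis unfolding g_def by (metis some_in_eq)
  qed
  have "inj_on g {e\<in>E. card e = 5}"
  proof (rule inj_onI, rule ccontr)
    fix S S' assume S: "S \<in> {e\<in>E. card e = 5}" "S' \<in> {e\<in>E. card e = 5}" "g S = g S'" "S \<noteq> S'"
    obtain a where a: "a \<in> S" "g S = S - {a}" using g S by blast
    obtain f where f: "f \<in> S'" "g S = S' - {f}" using g S by (metis (lifting) mem_Collect_eq)
    have "card (g S) = 4" using a S by simp
    then obtain b c d e where Q: "g S = {b,c,d,e}" "distinct [b,c,d,e]" by (rule card_eq_4_elim)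
    have S1: "S = insert a (g S)" and S2: "S' = insert f (g S)" using a f by blast+
    then have "a \<noteq> f" using S(4) by metis
    moreover have "a \<notin> g S" "f \<notin> g S" using a f by blast+
    \<comment> \<open>The two extra vertices \<open>a\<close> and \<open>f\<close> are the only pair
      without a common face at hand, so they are placed at the nonadjacent vertices 1 and 5 of
      \<open>F4\<close>.\<close>
    ultimately have "distinct [a,b,c,d,f,e]" using Q by auto
    moreover have "{a,b,c,d,e} \<in> E" "{f,b,c,d,e} \<in> E"
      using S(1,2) S1 S2 unfolding Q(1) by auto
    from this[THEN face_down] have "{a,b,c} \<in> E" "{a,d} \<in> E" "{a,e} \<in> E" "{b,d} \<in> E" "{c,e} \<in> E"
      "{d,f,e} \<in> E" "{b,f} \<in> E" "{c,f} \<in> E" by simp_all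
    ultimately show False using free free_of_F4_iff[OF complex] by blast
  qed
  moreover have "g ` {e\<in>E. card e = 5} \<subseteq> {e\<in>E. card e = 4}"
  proof
    fix s assume "s \<in> g ` {e\<in>E. card e = 5}"
    then obtain e where e: "e \<in> E" "card e = 5" "s = g e" by auto
    then obtain x where "x \<in> e" "s = e - {x}" using g by blast
    then show "s \<in> {e\<in>E. card e = 4}" using e by (auto intro: face_down[of e])
  qed
  ultimately show ?thesis using finite_faces by (intro card_inj_on_le) auto
qed

lemma F4_free_bound:
  assumes free: "free_of K F4"
  shows "real (card E) \<le> (real n + 1) ^ 3 + 4 * real n powr (15/4)"
proof -
  have "{e\<in>E. card e > 3} \<subseteq> {e\<in>E. card e = 4} \<union> {e\<in>E. card e = 5}"
    using F4_free_card_le5[OF free] by force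
  then have "card {e\<in>E. card e > 3} \<le> card ({e\<in>E. card e = 4} \<union> {e\<in>E. card e = 5})"
    using finite_faces by (intro card_mono) auto
  also have "\<dots> \<le> 2 * card {e\<in>E. card e = 4}"
    using card_Un_le[of "{e\<in>E. card e = 4}" "{e\<in>E. card e = 5}"] F4_free_card5[OF free] by linarith
  finally have "card E \<le> (n + 1) ^ 3 + 2 * card {e\<in>E. card e = 4}"
    using card_faces_le[of 3] by linarith
  then have "real (card E) \<le> real ((n + 1) ^ 3 + 2 * card {e\<in>E. card e = 4})" by (rule of_nat_mono)
  also have "\<dots> \<le> (real n + 1) ^ 3 + 2 * (real n * (2 * real n powr (11/4)))"
    using F4_free_card4[OF free] by (simp add: add.commute[of 1])
  also have "real n * (2 * real n powr (11/4)) = 2 * real n powr (15/4)"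
    using powr_add[of "real n" 1 "11/4"] by simp
  finally show ?thesis by simp
qed

end

section \<open>Primes in intervals\<close>

text \<open>Passing from \<open>n\<close> to \<open>Suc n\<close> raises \<open>n div d\<close> by
  one exactly for the divisors \<open>d\<close> of \<open>Suc n\<close>, and the von Mangoldt
  function summed over these gives \<open>ln (Suc n)\<close>.\<close>

lemma ln_fact_eq_sum_mangoldt:
  "ln (fact n) = (\<Sum>d=1..n. mangoldt d * real (n div d))"
proof (induction n)
  case 0
  then show ?case by simp
next
  case (Suc n)
  have "(\<Sum>d=1..Suc n. mangoldt d * real (Suc n div d)) =
      (\<Sum>d=1..Suc n. mangoldt d * real (n div d) + (if d dvd Suc n then mangoldt d else 0))"
    by (intro sum.cong refl) (auto simp: div_Suc dvd_eq_mod_eq_0 algebra_simps)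
  also have "\<dots> = (\<Sum>d=1..Suc n. mangoldt d * real (n div d)) +
      (\<Sum>d=1..Suc n. if d dvd Suc n then mangoldt d else 0)"
    by (rule sum.distrib)
  also have "(\<Sum>d=1..Suc n. mangoldt d * real (n div d)) = (\<Sum>d=1..n. mangoldt d * real (n div d))"
    by simp
  also have "(\<Sum>d=1..Suc n. if d dvd Suc n then mangoldt d else (0::real)) =
      (\<Sum>d | d dvd Suc n. mangoldt d)"
  proof -
    have "{d\<in>{1..Suc n}. d dvd Suc n} = {d. d dvd Suc n}"
      by (auto intro: dvd_imp_le Nat.gr0I simp: Suc_le_eq)
    then show ?thesis
      by (subst sum.inter_filter[symmetric]) (simp_all only: finite_atLeastAtMost)
  qed
  also have "\<dots> = ln (real (Suc n))"
    using mangoldt_sum[of "Suc n", where 'a = real] by simp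
  finally show ?case
    using Suc.IH by (simp add: ln_mult del: of_nat_Suc)
qed

text \<open>In the logarithm of the central binomial coefficient each \<open>mangoldt d\<close> has
  coefficient \<open>2 * n div d - 2 * (n div d)\<close>, which is at most 1.\<close>

lemma ln_central_binomial_le_sum_mangoldt:
  "ln (real (2 * n choose n)) \<le> (\<Sum>d=1..2*n. mangoldt d)"
proof -
  \<comment> \<open>The added terms vanish, since \<open>n div d = 0\<close> for
    \<open>d > n\<close>.\<close>
  have extend: "(\<Sum>d=1..n. mangoldt d * real (n div d)) = (\<Sum>d=1..2*n. mangoldt d * real (n div d))"
    by (rule sum.mono_neutral_left) auto
  have "real (2 * n choose n) = fact (2 * n) / (fact n * fact n)"
    by (subst binomial_fact) (auto simp: mult_2)
  then have "ln (real (2 * n choose n)) = ln (fact (2 * n)) - 2 * ln (fact n)"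
    by (simp add: ln_div ln_mult)
  also have "\<dots> = (\<Sum>d=1..2*n. mangoldt d * (real (2 * n div d) - 2 * real (n div d)))"
    unfolding ln_fact_eq_sum_mangoldt extend
    by (simp add: sum_distrib_left sum_subtractf algebra_simps)
  also have "\<dots> \<le> (\<Sum>d=1..2*n. mangoldt d * 1)"
  proof (intro sum_mono mult_left_mono mangoldt_nonneg)
    fix d assume "d \<in> {1..2*n}"
    then have d: "d > 0" by simp
    have "n mod d < d" using d by simp
    have "2 * n = 2 * (n div d) * d + 2 * (n mod d)"
      by (metis distrib_left_numeral div_mult_mod_eq mult.assoc)
    then have "2 * n < (2 * (n div d) + 2) * d"
      using \<open>n mod d < d\<close> by (simp add: algebra_simps)
    then have "2 * n div d < 2 * (n div d) + 2"
      using d by (simp add: div_less_iff_less_mult)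
    then show "real (2 * n div d) - 2 * real (n div d) \<le> 1"
      by linarith
  qed
  finally show ?thesis by simp
qed

lemma prod_primes_dvd:
  fixes n :: nat
  assumes "finite A" "\<And>p. p \<in> A \<Longrightarrow> prime p \<and> p dvd n"
  shows "\<Prod>A dvd n"
  using assms
proof (induction A)
  case (insert p A)
  have "coprime p (\<Prod>A)"
    using insert by (intro prod_coprime_right) (auto intro: primes_coprime)
  then show ?case
    using insert by (auto intro: divides_mult)
qed simp

text \<open>Erdos's induction. An even \<open>n > 2\<close> is not prime and reduces to
  \<open>n - 1\<close>. For \<open>n = 2 * k + 1\<close> the primes above \<open>k + 1\<close> all
  divide the binomial coefficient \<open>n choose k\<close>, which is at most
  \<open>4 ^ k\<close>.\<close>

lemma primorial_le: "\<Prod>{p. prime p \<and> p \<le> n} \<le> (4::nat) ^ n"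
proof (induction n rule: less_induct)
  case (less n)
  have fin: "finite {p. prime p \<and> p \<le> (m::nat)}" for m
    by (rule finite_subset[of _ "{..m}"]) auto
  consider "n \<le> 2" | "n > 2" "even n" | k where "n = 2 * k + 1" "k \<ge> 1"
    by (cases "n \<le> 2"; cases "even n") (auto elim!: oddE)
  then show ?case
  proof cases
    case 1
    then consider "n = 0" | "n = 1" | "n = 2" by linarith
    then show ?thesis
    proof cases
      case 3
      then have "{p. prime p \<and> p \<le> n} = {2}"
        by (auto simp: dest: prime_ge_2_nat)
      with 3 show ?thesis by simp
    next
      case 2
      then have "{p. prime p \<and> p \<le> n} = {}"
        by (auto simp: dest: prime_ge_2_nat)
      with 2 show ?thesis by (simp only: prod.empty) simp
    next
      case 1
      then have "{p. prime p \<and> p \<le> n} = {}" by auto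
      with 1 show ?thesis by (simp only: prod.empty) simp
    qed
  next
    case 2
    then have "\<not> prime n"
      using prime_odd_nat by blast
    then have "p \<le> n \<longleftrightarrow> p \<le> n - 1" if "prime p" for p
      using that by (cases "p = n") auto
    then have "{p. prime p \<and> p \<le> n} = {p. prime p \<and> p \<le> n - 1}"
      by auto
    then have "\<Prod>{p. prime p \<and> p \<le> n} \<le> 4 ^ (n - 1)"
      using less[of "n - 1"] 2 by simp
    also have "\<dots> \<le> 4 ^ n" by (rule power_increasing) auto
    finally show ?thesis .
  next
    case 3
    let ?B = "(2 * k + 1) choose k"
    let ?P = "{p. prime p \<and> k + 1 < p \<and> p \<le> n}"
    have finP: "finite ?P" by (rule finite_subset[OF _ fin[of n]]) auto
    have "\<Prod>?P dvd ?B"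
    proof (rule prod_primes_dvd[OF finP])
      fix p assume p: "p \<in> ?P"
      then have "p dvd fact n" by (simp add: prime_dvd_fact_iff)
      moreover have "fact n = ?B * (fact k * fact (k + 1))"
        using binomial_fact_lemma[of k n] 3 by (simp add: mult_ac)
      moreover have "\<not> p dvd fact k * fact (k + 1)"
        using p by (simp only: prime_dvd_mult_iff prime_dvd_fact_iff mem_Collect_eq) auto
      ultimately show "prime p \<and> p dvd ?B"
        using p by (metis mem_Collect_eq prime_dvd_mult_iff)
    qed
    then have "\<Prod>?P \<le> ?B"
      by (rule dvd_imp_le) simp
    also have "?B \<le> 4 ^ k"
    proof -
      \<comment> \<open>The coefficient occurs twice, by symmetry, in a row with sum
        \<open>2 * 4 ^ k\<close>.\<close>
      have "?B + ?B = (\<Sum>i\<in>{k, k + 1}. (2 * k + 1) choose i)"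
        using binomial_symmetric[of k "2 * k + 1"] by simp
      also have "\<dots> \<le> (\<Sum>i\<le>2 * k + 1. (2 * k + 1) choose i)"
        by (rule sum_mono2) auto
      also have "\<dots> = 2 * 4 ^ k"
        by (simp only: choose_row_sum) (simp add: power_mult)
      finally show ?thesis by simp
    qed
    finally have upper: "\<Prod>?P \<le> 4 ^ k" .
    have "{p. prime p \<and> p \<le> n} = {p. prime p \<and> p \<le> k + 1} \<union> ?P"
      using 3 by auto
    then have "\<Prod>{p. prime p \<and> p \<le> n} = \<Prod>{p. prime p \<and> p \<le> k + 1} * \<Prod>?P"
      using fin finP by (simp add: prod.union_disjoint disjoint_iff)
    also have "\<dots> \<le> 4 ^ (k + 1) * 4 ^ k"
      using less[of "k + 1"] 3 upper by (intro mult_mono) auto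
    also have "\<dots> = 4 ^ n"
      using 3 by (simp flip: power_add)
    finally show ?thesis .
  qed
qed

text \<open>Proper prime powers up to \<open>N\<close> have base at most \<open>sqrt N\<close> and
  exponent at most \<open>log 2 N\<close>, so they are few, and each contributes at most
  \<open>ln N\<close>.\<close>

lemma sum_mangoldt_le:
  assumes "N \<ge> 1"
  shows "(\<Sum>d=1..N. mangoldt d) \<le> (\<Sum>p | prime p \<and> p \<le> N. ln (real p)) +
    sqrt (real N) * (log 2 (real N) + 1) * ln (real N)"
proof -
  let ?S = "{d\<in>{1..N}. primepow d \<and> \<not> prime d}"
  let ?s = "nat \<lfloor>sqrt (real N)\<rfloor>" and ?l = "nat \<lfloor>log 2 (real N)\<rfloor>"
  have "?S \<subseteq> (\<lambda>(p,k). p ^ k) ` ({1..?s} \<times> {..?l})"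
  proof
    fix d assume d: "d \<in> ?S"
    then obtain p k where pk: "prime p" "k > 0" "d = p ^ k"
      by (auto simp: primepow_def)
    then have "k \<noteq> 1" using d by auto
    then have "k \<ge> 2" using pk by linarith
    have p2: "p \<ge> 2" using pk prime_ge_2_nat by blast
    have "p ^ 2 \<le> p ^ k" using \<open>k \<ge> 2\<close> p2 by (intro power_increasing) auto
    then have "real (p ^ 2) \<le> real N" using d pk by (intro of_nat_mono) auto
    then have "real p \<le> sqrt (real N)" by (simp add: real_le_rsqrt)
    then have "p \<le> ?s" by (simp add: le_nat_floor)
    moreover have "(2::nat) ^ k \<le> N"
      using power_mono[OF p2, of k] d pk by (metis (no_types, lifting) atLeastAtMost_iff le_trans mem_Collect_eq zero_le)
    then have "2 ^ k \<le> real N" by (metis of_nat_le_iff of_nat_numeral of_nat_power)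
    then have "real k \<le> log 2 (real N)" using assms by (simp add: le_log_iff powr_realpow)
    then have "k \<le> ?l" by (simp add: le_nat_floor)
    ultimately show "d \<in> (\<lambda>(p,k). p ^ k) ` ({1..?s} \<times> {..?l})"
      using pk p2 by (intro image_eqI[of _ _ "(p,k)"]) auto
  qed
  then have "card ?S \<le> card ((\<lambda>(p::nat,k). p ^ k) ` ({1..?s} \<times> {..?l}))"
    by (rule card_mono[rotated]) auto
  also have "\<dots> \<le> card ({1..?s} \<times> {..?l})" by (rule card_image_le) auto
  also have "\<dots> = ?s * (?l + 1)" by simp
  finally have "real (card ?S) \<le> real ?s * (real ?l + 1)"
    by (metis of_nat_1 of_nat_add of_nat_mono of_nat_mult)
  also have "\<dots> \<le> sqrt (real N) * (log 2 (real N) + 1)"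
    using assms by (intro mult_mono add_mono) (auto simp: of_nat_floor)
  finally have cardS: "real (card ?S) \<le> sqrt (real N) * (log 2 (real N) + 1)" .
  have "(\<Sum>d=1..N. mangoldt d) = (\<Sum>d\<in>{p. prime p \<and> p \<le> N} \<union> ?S. mangoldt d :: real)"
    by (rule sum.mono_neutral_right)
       (auto simp: mangoldt_def dest: prime_gt_0_nat)
  also have "\<dots> = (\<Sum>p | prime p \<and> p \<le> N. mangoldt p) + (\<Sum>d\<in>?S. mangoldt d)"
    by (rule sum.union_disjoint) (auto intro: finite_subset[of _ "{..N}"])
  also have "(\<Sum>d\<in>?S. mangoldt d) \<le> (\<Sum>d\<in>?S. ln (real N))"
  proof (rule sum_mono)
    fix d assume "d \<in> ?S"
    then have "mangoldt d \<le> ln (real d)" "ln (real d) \<le> ln (real N)"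
      by (auto intro: mangoldt_le)
    then show "mangoldt d \<le> ln (real N)" by linarith
  qed
  also have "\<dots> = real (card ?S) * ln (real N)" by simp
  also have "\<dots> \<le> sqrt (real N) * (log 2 (real N) + 1) * ln (real N)"
    using cardS assms by (intro mult_right_mono) auto
  finally show ?thesis by simp
qed

lemma sum_ln_primes_le: "(\<Sum>p | prime p \<and> p \<le> n. ln (real p)) \<le> real n * ln 4"
proof -
  have "(\<Sum>p | prime p \<and> p \<le> n. ln (real p)) = ln (\<Prod>p | prime p \<and> p \<le> n. real p)"
    by (rule ln_prod[symmetric]) (auto intro: finite_subset[of _ "{..n}"] dest: prime_gt_0_nat)
  also have "(\<Prod>p | prime p \<and> p \<le> n. real p) = real (\<Prod>{p. prime p \<and> p \<le> n})" by simp
  also have "ln \<dots> \<le> ln (real (4 ^ n))"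
    by (subst ln_le_cancel_iff)
       (use primorial_le[of n] in \<open>auto intro!: prod_pos dest: prime_gt_0_nat simp del: of_nat_prod of_nat_power simp flip: of_nat_power\<close>)
  also have "\<dots> = real n * ln 4" by (simp add: ln_realpow)
  finally show ?thesis .
qed

text \<open>Without such a prime, the sum of \<open>mangoldt\<close> up to \<open>2 * n\<close>
  would be about \<open>n / 2 * ln 4\<close> at most, yet it is about \<open>n * ln 4\<close> at
  least. Over the interval from \<open>n\<close> to \<open>2 * n\<close> these two main terms would
  coincide; any fixed ratio suffices for the application.\<close>

lemma eventually_prime_between: "\<forall>\<^sub>F n in sequentially. \<exists>p. prime p \<and> n div 2 < p \<and> p \<le> 2 * n"
proof -
  have "\<forall>\<^sub>F n in sequentially. real n * ln 4 - ln (2 * real n) >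
     real n / 2 * ln 4 + sqrt (2 * real n) * (log 2 (2 * real n) + 1) * ln (2 * real n)"
    by real_asymp
  then show ?thesis
    using eventually_gt_at_top[of 0]
  proof eventually_elim
    case (elim n)
    show ?case
    proof (rule ccontr)
      assume "\<not> ?case"
      then have eq: "{p. prime p \<and> p \<le> 2 * n} = {p. prime p \<and> p \<le> n div 2}"
        by (auto intro: ccontr)
      have "real n * ln 4 - ln (2 * real n) = ln (4 ^ n / (2 * real n))"
        using elim by (simp add: ln_div ln_realpow)
      also have "\<dots> \<le> ln (real (2 * n choose n))"
        using central_binomial_lower_bound[of n] elim by (subst ln_le_cancel_iff) auto
      also have "\<dots> \<le> (\<Sum>d=1..2*n. mangoldt d)"
        by (rule ln_central_binomial_le_sum_mangoldt)
      also have "\<dots> \<le> (\<Sum>p | prime p \<and> p \<le> n div 2. ln (real p)) +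
          sqrt (2 * real n) * (log 2 (2 * real n) + 1) * ln (2 * real n)"
        using sum_mangoldt_le[of "2 * n"] elim unfolding eq by simp
      also have "(\<Sum>p | prime p \<and> p \<le> n div 2. ln (real p)) \<le> real (n div 2) * ln 4"
        by (rule sum_ln_primes_le)
      also have "\<dots> \<le> real n / 2 * ln 4"
        by (intro mult_right_mono) auto
      finally show False using elim by simp
    qed
  qed
qed

section \<open>Cliques and tripartite complexes\<close>

text \<open>As no generator has more than \<open>r\<close> elements, an \<open>r\<close>-element
  face is itself a generator; only the generators of size \<open>r\<close> need to be mapped to
  edges.\<close>

lemma not_free_of_uniform_part:
  assumes M: "finite M" "\<And>m. m \<in> M \<Longrightarrow> finite m \<and> card m \<le> r"
    and \<phi>: "inj_on \<phi> (\<Union>M)" "\<phi> ` \<Union>M \<subseteq> verts G" "\<And>m. m \<in> M \<Longrightarrow> card m = r \<Longrightarrow> \<phi> ` m \<in> edges G"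
  shows "\<not> free_of G (uniform_part r (complex_of M))"
proof -
  have hyp: "hypergraph (uniform_part r (complex_of M))"
    using M by (auto simp: hypergraph_def uniform_part_def complex_of_def)
  have "\<phi> ` e \<in> edges G" if "m \<in> M" "e \<subseteq> m" "card e = r" for e m
  proof -
    have "e = m" using M(2)[OF that(1)] that by (metis card_seteq)
    then show ?thesis using \<phi>(3) that by blast
  qed
  then have "\<forall>e\<in>edges (uniform_part r (complex_of M)). \<phi> ` e \<in> edges G"
    by (auto simp: uniform_part_def complex_of_def)
  then show ?thesis
    unfolding free_of_iff[OF hyp] using \<phi> by (auto simp: uniform_part_def complex_of_def)
qed

text \<open>The triples of \<open>F1\<close> are two edges meeting in exactly one vertex; those of
  \<open>F2\<close>, \<open>F3\<close> and \<open>F4\<close> below are two disjoint edges.\<close>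

lemma uniform_part_F1_free:
  assumes G: "hypergraph G" and free: "free_of G (uniform_part 3 F1)"
    and e: "{a,b,c} \<in> edges G" "{a,d,e} \<in> edges G"
  shows "\<not> distinct [a,b,c,d,e]"
proof
  assume "distinct [a,b,c,d,e]"
  then obtain \<phi> :: "nat \<Rightarrow> 'a" where \<phi>: "inj_on \<phi> {1,2,3,4,5}"
    "{\<phi> 1, \<phi> 2, \<phi> 3} \<in> edges G \<and> {\<phi> 1, \<phi> 4, \<phi> 5} \<in> edges G"
    using ex_inj_on_5[of "\<lambda>a b c d e. {a,b,c} \<in> edges G \<and> {a,d,e} \<in> edges G"] e by blast
  have U: "\<Union>{{1,2,3}, {1,4,5}, {3,4}, {3,5}} = {1,2,3,4,5::nat}" by auto
  have "\<not> free_of G (uniform_part 3 F1)"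
    unfolding F1_def
  proof (rule not_free_of_uniform_part, unfold U)
    show "\<phi> ` {1,2,3,4,5} \<subseteq> verts G" using \<phi>(2) G by (auto simp: hypergraph_def)
  qed (use \<phi> in auto)
  then show False using free by blast
qed

lemma uniform_part_F234_free:
  assumes G: "hypergraph G" and F: "F \<in> {F2, F3, F4}" and free: "free_of G (uniform_part 3 F)"
    and e: "{a,b,c} \<in> edges G" "{d,e,f} \<in> edges G"
  shows "\<not> distinct [a,b,c,d,e,f]"
proof
  assume "distinct [a,b,c,d,e,f]"
  then obtain \<phi> :: "nat \<Rightarrow> 'a" where \<phi>: "inj_on \<phi> {1,2,3,4,5,6}"
    "{\<phi> 1, \<phi> 2, \<phi> 3} \<in> edges G \<and> {\<phi> 4, \<phi> 5, \<phi> 6} \<in> edges G"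
    using ex_inj_on_6[of "\<lambda>a b c d e f. {a,b,c} \<in> edges G \<and> {d,e,f} \<in> edges G"] e by blast
  have "\<not> free_of G (uniform_part 3 (complex_of M))"
    if M: "M \<in> {{{1,2,3}, {4,5,6}, {1,4}, {1,5}, {1,6}},
        {{1,2,3}, {4,5,6}, {1,4}, {1,5}, {2,4}, {2,5}},
        {{1,2,3}, {4,5,6}, {1,4}, {1,6}, {2,4}, {2,5}, {3,5}, {3,6}}}" for M :: "nat set set"
  proof (rule not_free_of_uniform_part)
    have U: "\<Union>M = {1,2,3,4,5,6}" using M by auto
    show "inj_on \<phi> (\<Union>M)" unfolding U by (rule \<phi>)
    show "\<phi> ` \<Union>M \<subseteq> verts G" unfolding U using \<phi>(2) G by (auto simp: hypergraph_def)
    show "finite M" using M by auto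
    show "finite m \<and> card m \<le> 3" if "m \<in> M" for m
      using M that by auto
    show "\<phi> ` m \<in> edges G" if "m \<in> M" "card m = 3" for m
      using M that \<phi>(2) by auto
  qed
  then show False using F free unfolding F2_def F3_def F4_def by blast
qed

text \<open>A clique with at least three vertices inside an edge is the edge itself, so all
  alternatives of \<open>clique3\<close> reduce to the complete case.\<close>

lemma clique3_triple:
  assumes G: "uniform_hypergraph 3 G" and T: "clique3 G T" "3 \<le> card T" and S: "S \<subseteq> T" "card S = 3"
  shows "S \<in> edges G"
proof -
  consider v where "T = {v}" | e where "e \<in> edges G" "T \<subseteq> e" | "\<forall>S. S \<subseteq> T \<and> card S = 3 \<longrightarrow> S \<in> edges G"
    using T unfolding clique3_def by blast
  then show ?thesis
  proof cases
    case 1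
    then show ?thesis using T by simp
  next
    case (2 e)
    then have "card e = 3" "finite e" using G by (auto simp: uniform_hypergraph_def hypergraph_def intro: finite_subset)
    then have "S = e" using S 2 by (metis card_seteq dual_order.refl order_trans)
    then show ?thesis using 2 by simp
  next
    case 3
    then show ?thesis using S by blast
  qed
qed

text \<open>If \<open>vab\<close> is an edge, a clique through \<open>v\<close> has at most one
  vertex outside \<open>vab\<close>: two such vertices would form with \<open>v\<close> an edge
  meeting \<open>vab\<close> only in \<open>v\<close>.\<close>

lemma card_cliques_no_common_vertex_le:
  assumes G: "uniform_hypergraph 3 G" "card (verts G) = n"
    and free: "\<And>a b c d e. {a,b,c} \<in> edges G \<Longrightarrow> {a,d,e} \<in> edges G \<Longrightarrow> \<not> distinct [a,b,c,d,e]"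
  shows "card {T. clique3 G T \<and> 3 \<le> card T} \<le> 8 * (n + 1) ^ 2"
proof -
  have fin: "finite (verts G)" using G by (simp add: uniform_hypergraph_def hypergraph_def)
  have "card {T. clique3 G T \<and> 3 \<le> card T} \<le> card (verts G) * (2 ^ 3 * (card (verts G) + 1) ^ 1)"
  proof (rule card_dominated_le[where P = "\<lambda>x S. x \<in> S"])
    fix T assume "T \<in> {T. clique3 G T \<and> 3 \<le> card T}"
    then have T: "clique3 G T" "3 \<le> card T" by auto
    then obtain S where S: "S \<subseteq> T" "card S = 3" by (metis obtain_subset_with_card_n)
    then obtain v a b where vab: "S = {v,a,b}" "distinct [v,a,b]" by (auto simp: card_3_iff)
    have edge: "{v,a,b} \<in> edges G" using clique3_triple[OF G(1) T S] vab by simp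
    have near: "card (R - {v,a,b}) \<le> 1" if R: "clique3 G R" "3 \<le> card R" "v \<in> R" for R
    proof (rule ccontr)
      assume "\<not> ?thesis"
      then have "card (R - {v,a,b}) \<ge> 2" by simp
      then obtain P where "P \<subseteq> R - {v,a,b}" "card P = 2" by (metis obtain_subset_with_card_n)
      then obtain y z where yz: "{y, z} \<subseteq> R - {v,a,b}" "y \<noteq> z" by (metis card_2_iff)
      have "{v,y,z} \<subseteq> R" "card {v,y,z} = 3" using yz R(3) by auto
      then have "{v,y,z} \<in> edges G" by (rule clique3_triple[OF G(1) R(1,2)])
      moreover have "distinct [v,a,b,y,z]" using vab yz by auto
      ultimately show False using free edge by blast
    qed
    have "v \<in> T" using S vab by simp
    then have "v \<in> verts G" using T by (auto simp: clique3_def)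
    moreover have "finite {v,a,b}" "card {v,a,b} \<le> 3" using vab by simp_all
    ultimately show "\<exists>v\<in>verts G. v \<in> T \<and> (\<exists>B. finite B \<and> card B \<le> 3 \<and>
       (\<forall>S\<in>{T. clique3 G T \<and> 3 \<le> card T}. v \<in> S \<longrightarrow> card (S - B) \<le> 1))"
      using near \<open>v \<in> T\<close> by blast
  qed (use fin in \<open>auto simp: clique3_def\<close>)
  also have "\<dots> = n * (8 * (n + 1))" using G by simp
  also have "\<dots> \<le> 8 * (n + 1) ^ 2" by (simp add: power2_eq_square algebra_simps)
  finally show ?thesis .
qed

text \<open>Every clique has at most two vertices outside a fixed edge, since three would form a
  disjoint edge. One edge thus dominates all cliques, hence the one-element index set.\<close>

lemma card_cliques_intersecting_le:
  assumes G: "uniform_hypergraph 3 G" "card (verts G) = n"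
    and free: "\<And>a b c d e f. {a,b,c} \<in> edges G \<Longrightarrow> {d,e,f} \<in> edges G \<Longrightarrow> \<not> distinct [a,b,c,d,e,f]"
  shows "card {T. clique3 G T \<and> 3 \<le> card T} \<le> 8 * (n + 1) ^ 2"
proof -
  have fin: "finite (verts G)" using G by (simp add: uniform_hypergraph_def hypergraph_def)
  have "card {T. clique3 G T \<and> 3 \<le> card T} \<le> card {()} * (2 ^ 3 * (card (verts G) + 1) ^ 2)"
  proof (rule card_dominated_le[where P = "\<lambda>_ _. True"])
    fix T assume "T \<in> {T. clique3 G T \<and> 3 \<le> card T}"
    then have T: "clique3 G T" "3 \<le> card T" by auto
    then obtain S where S: "S \<subseteq> T" "card S = 3" by (metis obtain_subset_with_card_n)
    then obtain v a b where vab: "S = {v,a,b}" "distinct [v,a,b]" by (auto simp: card_3_iff)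
    have edge: "{v,a,b} \<in> edges G" using clique3_triple[OF G(1) T S] vab by simp
    have near: "card (R - {v,a,b}) \<le> 2" if R: "clique3 G R" "3 \<le> card R" for R
    proof (rule ccontr)
      assume "\<not> ?thesis"
      then have "card (R - {v,a,b}) \<ge> 3" by simp
      then obtain P where P: "P \<subseteq> R - {v,a,b}" "card P = 3" by (metis obtain_subset_with_card_n)
      then obtain x y z where xyz: "P = {x, y, z}" "distinct [x,y,z]" by (auto simp: card_3_iff)
      have "P \<in> edges G" using P by (intro clique3_triple[OF G(1) R]) auto
      moreover have "distinct [v,a,b,x,y,z]" using vab xyz P(1) by auto
      ultimately show False using free edge xyz(1) by blast
    qed
    have "finite {v,a,b}" "card {v,a,b} \<le> 3" using vab by simp_all
    then show "\<exists>v\<in>{()}. True \<and> (\<exists>B. finite B \<and> card B \<le> 3 \<and>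
       (\<forall>S\<in>{T. clique3 G T \<and> 3 \<le> card T}. True \<longrightarrow> card (S - B) \<le> 2))"
      using near by blast
  qed (use fin in \<open>auto simp: clique3_def\<close>)
  then show ?thesis using G by simp
qed

lemma ex3_clique_F_le:
  assumes "F \<in> {F1, F2, F3, F4}"
  shows "ex3_clique n (uniform_part 3 F) \<le> 8 * (n + 1) ^ 2"
proof (rule ex3_clique_le)
  have "abstract_simplicial_complex F" using assms F_simplicial by auto
  then show "hypergraph (uniform_part 3 F)"
    by (auto simp: abstract_simplicial_complex_def hypergraph_def uniform_part_def)
  have "{1,2,3} \<in> edges F"
    using assms by (auto simp: F1_def F2_def F3_def F4_def complex_of_def)
  moreover have "card {1,2,3::nat} = 3" by simp
  ultimately show "edges (uniform_part 3 F) \<noteq> {}"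
    unfolding uniform_part_def by fastforce
next
  fix G :: "nat hgraph"
  assume G: "uniform_hypergraph 3 G" "card (verts G) = n" "free_of G (uniform_part 3 F)"
  then have hyp: "hypergraph G" by (simp add: uniform_hypergraph_def)
  show "card {T. clique3 G T \<and> 3 \<le> card T} \<le> 8 * (n + 1) ^ 2"
  proof (cases "F = F1")
    case True
    then show ?thesis
      using G uniform_part_F1_free[OF hyp] by (intro card_cliques_no_common_vertex_le) auto
  next
    case False
    then have "F \<in> {F2, F3, F4}" using assms by auto
    then show ?thesis
      using G uniform_part_F234_free[OF hyp _ G(3)] by (intro card_cliques_intersecting_le) blast+
  qed
qed

section \<open>Tripartite complexes\<close>

locale tripartite =
  fixes V A B C :: "'a set" and R :: "('a \<times> 'a) set"
  assumes finite_V: "finite V" and V_nonempty: "V \<noteq> {}"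
    and parts: "A \<subseteq> V" "B \<subseteq> V" "C \<subseteq> V" "A \<inter> B = {}" "A \<inter> C = {}" "B \<inter> C = {}"
    and R: "R \<subseteq> A \<times> B"
begin

text \<open>A bipartite graph \<open>R\<close> joined to the independent set \<open>C\<close>. The
  singletons keep as vertices those elements of \<open>V\<close> that lie in no triple.\<close>

definition K where
  "K = complex_of ((\<lambda>v. {v}) ` V \<union> (\<lambda>((a, b), c). {a, b, c}) ` (R \<times> C))"

lemma finite_parts: "finite A" "finite B" "finite C"
  using parts(1-3) by (auto intro: finite_subset[OF _ finite_V])

lemma finite_R: "finite R"
  by (rule finite_subset[OF R]) (intro finite_cartesian_product finite_parts)

lemma complex_K: "abstract_simplicial_complex K"
  unfolding K_def using finite_V V_nonempty finite_R finite_parts by (intro complex_of_simplicial) auto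

lemma verts_K: "verts K = V"
  using parts R by (auto simp: K_def complex_of_def)

lemma card_edges_K_ge: "card R * card C \<le> card (edges K)"
proof -
  have "inj_on (\<lambda>((a, b), c). {a, b, c}) (R \<times> C)"
  proof (rule inj_onI)
    fix p q assume pq: "p \<in> R \<times> C" "q \<in> R \<times> C"
      "(\<lambda>((a, b), c). {a, b, c}) p = (\<lambda>((a, b), c). {a, b, c}) q"
    obtain a b c a' b' c' where p: "p = ((a, b), c)" and q: "q = ((a', b'), c')" by (metis surj_pair)
    have *: "(a, b) \<in> R" "c \<in> C" "(a', b') \<in> R" "c' \<in> C" "{a, b, c} = {a', b', c'}"
      using pq by (simp_all add: p q)
    then have "a \<in> A" "b \<in> B" "a' \<in> A" "b' \<in> B" using R by auto
    moreover have "a \<in> {a', b', c'}" "b \<in> {a', b', c'}" "c \<in> {a', b', c'}" using *(5) by blast+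
    ultimately have "a = a'" "b = b'" "c = c'" using parts *(2,4) by blast+
    then show "p = q" by (simp add: p q)
  qed
  then have "card R * card C = card ((\<lambda>((a, b), c). {a, b, c}) ` (R \<times> C))"
    by (simp add: card_image card_cartesian_product)
  also have "\<dots> \<le> card (edges K)"
  proof (rule card_mono)
    show "finite (edges K)"
      using complex_K finite_V verts_K unfolding abstract_simplicial_complex_def hypergraph_def
      by (meson PowI finite_Pow_iff finite_subset subsetI)
    show "(\<lambda>((a, b), c). {a, b, c}) ` (R \<times> C) \<subseteq> edges K"
      unfolding K_def complex_of_def hgraph.simps by blast
  qed
  finally show ?thesis .
qed

text \<open>A proper 3-colouring of the 1-skeleton. Vertices outside the three parts also get colour
  2, which is harmless because they are isolated.\<close>

definition col :: "'a \<Rightarrow> nat" where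
  "col v = (if v \<in> A then 0 else if v \<in> B then 1 else 2)"

lemma adjacent:
  assumes "{u, v} \<in> edges K" "u \<noteq> v"
  shows "col u \<noteq> col v" "u \<in> A \<Longrightarrow> v \<in> B \<Longrightarrow> (u, v) \<in> R"
proof -
  obtain a b c where abc: "(a, b) \<in> R" "c \<in> C" "{u, v} \<subseteq> {a, b, c}"
    using assms by (auto simp: K_def complex_of_def)
  then have mem: "a \<in> A" "b \<in> B" using R by auto
  then have cols: "col a = 0" "col b = 1" "col c = 2" using parts abc by (auto simp: col_def)
  have "u = a \<or> u = b \<or> u = c" "v = a \<or> v = b \<or> v = c" using abc(3) by auto
  then show "col u \<noteq> col v" "u \<in> A \<Longrightarrow> v \<in> B \<Longrightarrow> (u, v) \<in> R"
    using assms(2) cols mem abc parts by (auto simp: disjoint_iff)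
qed

lemma col_le: "col v \<le> 2"
  by (simp add: col_def)

lemma col_0: "col v = 0 \<Longrightarrow> v \<in> A" and col_1: "col v = 1 \<Longrightarrow> v \<in> B"
  by (auto simp: col_def split: if_splits)

lemma no_K4:
  assumes "distinct [a,b,c,d]" "{a,b} \<in> edges K" "{a,c} \<in> edges K" "{a,d} \<in> edges K"
    "{b,c} \<in> edges K" "{b,d} \<in> edges K" "{c,d} \<in> edges K"
  shows False
proof -
  have "col a \<noteq> col b" "col a \<noteq> col c" "col a \<noteq> col d" "col b \<noteq> col c" "col b \<noteq> col d" "col c \<noteq> col d"
    using assms by (simp_all add: adjacent(1))
  then show False using col_le[of a] col_le[of b] col_le[of c] col_le[of d] by linarith
qed

lemma edges_down: "e \<in> edges K \<Longrightarrow> s \<subseteq> e \<Longrightarrow> s \<in> edges K"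
  using complex_K by (auto simp: abstract_simplicial_complex_def)

text \<open>The forbidden K4 has the vertices \<open>a\<close>, \<open>c\<close>, \<open>d\<close>,
  \<open>e\<close> here, \<open>a\<close>, \<open>d\<close>, \<open>e\<close>, \<open>f\<close> in
  \<open>F2\<close> and \<open>a\<close>, \<open>b\<close>, \<open>d\<close>, \<open>e\<close> in
  \<open>F3\<close>.\<close>

lemma free_F1: "free_of K F1"
proof -
  have False if d: "distinct [a,b,c,d,e]" and e: "{a,b,c} \<in> edges K" "{a,d,e} \<in> edges K"
    "{c,d} \<in> edges K" "{c,e} \<in> edges K" for a b c d e
    using no_K4[of a c d e] d e(3,4) edges_down[OF e(1), of "{a,c}"] edges_down[OF e(2)] by simp
  then show ?thesis unfolding free_of_F1_iff[OF complex_K] by blast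
qed

lemma free_F2: "free_of K F2"
proof -
  have False if d: "distinct [a,b,c,d,e,f]" and e: "{d,e,f} \<in> edges K" "{a,d} \<in> edges K"
    "{a,e} \<in> edges K" "{a,f} \<in> edges K" for a b c d e f
    using no_K4[of a d e f] d e(2-4) edges_down[OF e(1)] by simp
  then show ?thesis unfolding free_of_F2_iff[OF complex_K] by blast
qed

lemma free_F3: "free_of K F3"
proof -
  have False if d: "distinct [a,b,c,d,e,f]" and e: "{a,b,c} \<in> edges K" "{d,e,f} \<in> edges K"
    "{a,d} \<in> edges K" "{a,e} \<in> edges K" "{b,d} \<in> edges K" "{b,e} \<in> edges K" for a b c d e f
    using no_K4[of a b d e] d e(3-6) edges_down[OF e(1), of "{a,b}"] edges_down[OF e(2), of "{d,e}"] by simp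
  then show ?thesis unfolding free_of_F3_iff[OF complex_K] by blast
qed

text \<open>The 1-skeleton of \<open>F4\<close> is the octahedron, whose only proper 3-colouring has the three
  pairs of antipodal vertices as colour classes.\<close>
lemma free_F4:
  assumes C4: "\<And>x x' y y'. x \<noteq> x' \<Longrightarrow> y \<noteq> y' \<Longrightarrow> (x, y) \<in> R \<Longrightarrow> (x, y') \<in> R \<Longrightarrow>
      (x', y) \<in> R \<Longrightarrow> (x', y') \<in> R \<Longrightarrow> False"
  shows "free_of K F4"
proof -
  have no_C4: False
    if "col x = 0" "col x' = 0" "col y = 1" "col y' = 1" "x \<noteq> x'" "y \<noteq> y'"
      "{x,y} \<in> edges K" "{x,y'} \<in> edges K" "{x',y} \<in> edges K" "{x',y'} \<in> edges K" for x x' y y'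
  proof -
    have mem: "x \<in> A" "x' \<in> A" "y \<in> B" "y' \<in> B"
      using that(1-4) by (blast intro: col_0 col_1)+
    then have "x \<noteq> y" "x \<noteq> y'" "x' \<noteq> y" "x' \<noteq> y'" using parts by blast+
    then have "(x, y) \<in> R" "(x, y') \<in> R" "(x', y) \<in> R" "(x', y') \<in> R"
      using adjacent(2) that(7-10) mem by blast+
    then show False by (rule C4[OF that(5,6)])
  qed
  have False if d: "distinct [a,b,c,d,e,f]" and t: "{a,b,c} \<in> edges K" "{d,e,f} \<in> edges K"
    and e: "{a,d} \<in> edges K" "{a,f} \<in> edges K" "{b,d} \<in> edges K" "{b,e} \<in> edges K"
    "{c,e} \<in> edges K" "{c,f} \<in> edges K" for a b c d e f
  proof -
    have t': "{a,b} \<in> edges K" "{a,c} \<in> edges K" "{b,c} \<in> edges K" "{d,e} \<in> edges K"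
      "{d,f} \<in> edges K" "{e,f} \<in> edges K"
      using edges_down[OF t(1)] edges_down[OF t(2)] by simp_all
    have sym: "{e,b} \<in> edges K" "{e,f} \<in> edges K" "{e,c} \<in> edges K" "{e,d} \<in> edges K" "{f,a} \<in> edges K"
      "{f,e} \<in> edges K" "{f,c} \<in> edges K" "{f,d} \<in> edges K" "{c,a} \<in> edges K" "{c,b} \<in> edges K"
      "{d,a} \<in> edges K" "{d,b} \<in> edges K" "{b,a} \<in> edges K"
      using e t' by (metis insert_commute)+
    have ne: "col a \<noteq> col b" "col a \<noteq> col c" "col b \<noteq> col c" "col a \<noteq> col d" "col b \<noteq> col d"
      "col b \<noteq> col e" "col c \<noteq> col e" "col a \<noteq> col f" "col c \<noteq> col f"
      using e t' d by (simp_all add: adjacent(1))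
    note le = col_le[of a] col_le[of b] col_le[of c] col_le[of d] col_le[of e] col_le[of f]
    \<comment> \<open>Each of \<open>d\<close>, \<open>e\<close>, \<open>f\<close> is adjacent to
      two vertices of the triangle \<open>abc\<close> and is forced to take the colour of the
      third.\<close>
    have eq: "col e = col a" "col f = col b" "col d = col c"
      subgoal using ne(1-3,6,7) le by linarith
      subgoal using ne(1-3,8,9) le by linarith
      subgoal using ne(1-3,4,5) le by linarith
      done
    have "a \<noteq> e" "b \<noteq> f" "c \<noteq> d" using d by auto
    \<comment> \<open>The triangle \<open>abc\<close> uses all three colours. The two antipodal
      pairs coloured 0 and 1 lie in \<open>A\<close> and \<open>B\<close> and span a 4-cycle of
      \<open>R\<close>.\<close>
    consider "col a = 0" "col b = 1" | "col a = 1" "col b = 0" | "col a = 0" "col c = 1"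
      | "col a = 1" "col c = 0" | "col b = 0" "col c = 1" | "col b = 1" "col c = 0"
      using ne(1-3) le(1-3) by (auto simp: le_Suc_eq numeral_2_eq_2)
    then show False
    proof cases
      case 1
      then show ?thesis using no_C4[of a e b f] eq \<open>a \<noteq> e\<close> \<open>b \<noteq> f\<close> e t' sym by simp
    next
      case 2
      then show ?thesis using no_C4[of b f a e] eq \<open>a \<noteq> e\<close> \<open>b \<noteq> f\<close> e t' sym by simp
    next
      case 3
      then show ?thesis using no_C4[of a e c d] eq \<open>a \<noteq> e\<close> \<open>c \<noteq> d\<close> e t' sym by simp
    next
      case 4
      then show ?thesis using no_C4[of c d a e] eq \<open>a \<noteq> e\<close> \<open>c \<noteq> d\<close> e t' sym by simp
    next
      case 5
      then show ?thesis using no_C4[of b f c d] eq \<open>b \<noteq> f\<close> \<open>c \<noteq> d\<close> e t' sym by simp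
    next
      case 6
      then show ?thesis using no_C4[of c d b f] eq \<open>b \<noteq> f\<close> \<open>c \<noteq> d\<close> e t' sym by simp
    qed
  qed
  then show ?thesis unfolding free_of_F4_iff[OF complex_K] by blast
qed

end

section \<open>Asymptotics\<close>

text \<open>The complete tripartite complex with three parts of size \<open>n div 3\<close>; the at
  most two leftover vertices stay isolated.\<close>

lemma ex_complex_F123_ge:
  assumes "n > 0" "F \<in> {F1, F2, F3}"
  shows "(n div 3) ^ 3 \<le> ex_complex n F"
proof -
  let ?q = "n div 3"
  interpret T: tripartite "{..<n}" "{..<?q}" "{?q..<2 * ?q}" "{2 * ?q..<3 * ?q}" "{..<?q} \<times> {?q..<2 * ?q}"
    by unfold_locales (use assms(1) in auto)
  have "free_of T.K F" using assms(2) T.free_F1 T.free_F2 T.free_F3 by auto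
  then have "card (edges T.K) \<le> ex_complex n F"
    using T.complex_K by (intro ex_complex_ge) (simp_all add: T.verts_K)
  moreover have "?q ^ 3 = card ({..<?q} \<times> {?q..<2 * ?q}) * card {2 * ?q..<3 * ?q}"
    by (simp add: card_cartesian_product power3_eq_cube)
  ultimately show ?thesis using T.card_edges_K_ge by simp
qed

text \<open>Two lines that agree at two abscissas coincide: subtracting the congruences shows that
  \<open>p\<close> divides \<open>(m - m') * (x - x')\<close>. The integers make the subtraction
  possible.\<close>

lemma incidence_lines_eq:
  fixes p m m' c c' x x' :: nat
  assumes p: "prime p" and lt: "m < p" "m' < p" "c < p" "c' < p" "x < p" "x' < p" and "x \<noteq> x'"
    and "(m * x + c) mod p = (m' * x + c') mod p" "(m * x' + c) mod p = (m' * x' + c') mod p"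
  shows "m = m' \<and> c = c'"
proof -
  have "[int (m * x + c) = int (m' * x + c')] (mod int p)"
    "[int (m * x' + c) = int (m' * x' + c')] (mod int p)"
    using assms(9,10) by (simp_all only: cong_int_iff) (simp_all add: unique_euclidean_semiring_class.cong_def)
  then have "int p dvd int (m * x + c) - int (m' * x + c')"
    "int p dvd int (m * x' + c) - int (m' * x' + c')"
    by (simp_all add: cong_iff_dvd_diff)
  then have "int p dvd (int (m * x + c) - int (m' * x + c')) - (int (m * x' + c) - int (m' * x' + c'))"
    by (rule dvd_diff)
  also have "\<dots> = (int m - int m') * (int x - int x')"
    by (simp add: algebra_simps)
  finally have "int p dvd int m - int m' \<or> int p dvd int x - int x'"
    using p by (simp add: prime_dvd_mult_iff)
  moreover have small: "a = b" if "int p dvd int a - int b" "a < p" "b < p" for a b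
    using that by (metis cong_iff_dvd_diff cong_int_iff cong_less_modulus_unique_nat)
  ultimately have m: "m = m'" using lt \<open>x \<noteq> x'\<close> by blast
  then have "int p dvd int c - int c'"
    using \<open>int p dvd int (m * x + c) - int (m' * x + c')\<close> by simp
  then show ?thesis using small lt m by blast
qed

text \<open>The point \<open>(x, y)\<close> of the affine plane over the field with \<open>p\<close> elements is encoded as
  \<open>x p + y\<close>, the line \<open>y = m x + c\<close> as \<open>p\<^sup>2 + m p + c\<close>.\<close>
lemma ex_complex_F4_ge:
  assumes p: "prime p" and n: "2 * p ^ 2 \<le> n"
  shows "p ^ 3 * (n - 2 * p ^ 2) \<le> ex_complex n F4"
proof -
  have p0: "p > 0" using p by (simp add: prime_gt_0_nat)
  define R where "R = {(a, b). a < p ^ 2 \<and> p ^ 2 \<le> b \<and> b < 2 * p ^ 2 \<and>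
    a mod p = (((b - p ^ 2) div p) * (a div p) + (b - p ^ 2) mod p) mod p}"
  have sub: "R \<subseteq> {..<p ^ 2} \<times> {p ^ 2..<2 * p ^ 2}" by (auto simp: R_def)
  have divlt: "a div p < p" if "a < p ^ 2" for a
    using that by (simp add: less_mult_imp_div_less power2_eq_square)
  have n0: "n > 0" using n p0 by (metis gr0I mult_eq_0_iff not_le power_not_zero zero_neq_numeral)
  interpret T: tripartite "{..<n}" "{..<p ^ 2}" "{p ^ 2..<2 * p ^ 2}" "{2 * p ^ 2..<n}" R
    by unfold_locales (use n n0 sub in auto)
  have "free_of T.K F4"
  proof (rule T.free_F4)
    fix a a' b b'
    assume ne: "a \<noteq> a'" "b \<noteq> b'" and inR: "(a, b) \<in> R" "(a, b') \<in> R" "(a', b) \<in> R" "(a', b') \<in> R"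
    define m c m' c' where mc: "m = (b - p ^ 2) div p" "c = (b - p ^ 2) mod p"
      "m' = (b' - p ^ 2) div p" "c' = (b' - p ^ 2) mod p"
    have bd: "a < p ^ 2" "a' < p ^ 2" "p ^ 2 \<le> b" "b < 2 * p ^ 2" "p ^ 2 \<le> b'" "b' < 2 * p ^ 2"
      using inR by (auto simp: R_def)
    have inc: "a mod p = (m * (a div p) + c) mod p" "a mod p = (m' * (a div p) + c') mod p"
      "a' mod p = (m * (a' div p) + c) mod p" "a' mod p = (m' * (a' div p) + c') mod p"
      using inR by (simp_all add: R_def mc)
    have lt: "m < p" "m' < p" "c < p" "c' < p" "a div p < p" "a' div p < p"
      using bd p0 by (auto simp: mc intro!: divlt)
    show False
    \<comment> \<open>Points with equal abscissas on a common line are equal. Otherwise the two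
      lines share two points with different abscissas and coincide.\<close>
    proof (cases "a div p = a' div p")
      case True
      then have "a mod p = a' mod p" using inc(1,3) by simp
      then show False using True ne(1) by (metis div_mult_mod_eq)
    next
      case False
      then have "m = m' \<and> c = c'"
        using incidence_lines_eq[OF p lt(1-6)] inc by simp
      then have "b - p ^ 2 = b' - p ^ 2" unfolding mc by (metis div_mult_mod_eq)
      then show False using bd ne(2) by simp
    qed
  qed
  then have "card (edges T.K) \<le> ex_complex n F4"
    using T.complex_K by (intro ex_complex_ge) (simp_all add: T.verts_K)
  moreover have "p ^ 3 \<le> card R"
  proof -
    \<comment> \<open>An incidence is determined by a line and an abscissa, so there are
      \<open>p ^ 3\<close> of them.\<close>
    let ?f = "\<lambda>(x, m, c). (x * p + (m * x + c) mod p, p ^ 2 + (m * p + c))"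
    have lt2: "x * p + y < p ^ 2" if "x < p" "y < p" for x y
    proof -
      have "x * p + y < (x + 1) * p" using that by simp
      also have "\<dots> \<le> p * p" using that by (intro mult_right_mono) auto
      finally show ?thesis by (simp add: power2_eq_square)
    qed
    have "inj_on ?f ({..<p} \<times> {..<p} \<times> {..<p})"
    proof (rule inj_onI)
      fix s t assume st: "s \<in> {..<p} \<times> {..<p} \<times> {..<p}" "t \<in> {..<p} \<times> {..<p} \<times> {..<p}" "?f s = ?f t"
      obtain x m c x' m' c' where s: "s = (x, m, c)" and t: "t = (x', m', c')" by (metis surj_pair)
      have lt: "c < p" "c' < p" and 1: "x * p + (m * x + c) mod p = x' * p + (m' * x' + c') mod p"
        and 2: "m * p + c = m' * p + c'" using st by (simp_all add: s t)
      have "x = x'" using arg_cong[OF 1, of "\<lambda>v. v div p"] p0 by simp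
      moreover have "m = m'" using arg_cong[OF 2, of "\<lambda>v. v div p"] lt by simp
      ultimately show "s = t" using 2 by (simp add: s t)
    qed
    moreover have "?f ` ({..<p} \<times> {..<p} \<times> {..<p}) \<subseteq> R"
      using lt2 p0 by (auto simp: R_def)
    moreover have "finite R" using sub by (rule finite_subset) simp
    ultimately have "card ({..<p} \<times> {..<p} \<times> {..<p}) \<le> card R" by (rule card_inj_on_le)
    then show ?thesis by (simp add: card_cartesian_product power3_eq_cube mult.assoc)
  qed
  then have "p ^ 3 * (n - 2 * p ^ 2) \<le> card R * card {2 * p ^ 2..<n}"
    by (simp add: mult_right_mono)
  ultimately show ?thesis using T.card_edges_K_ge by linarith
qed

lemma eventually_ex_complex_F4_ge:
  "\<forall>\<^sub>F n in sequentially. real n powr (5/2) / 1024 \<le> real (ex_complex n F4)"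
proof -
  \<comment> \<open>With this choice \<open>p \<le> 2 * k n\<close> gives
    \<open>4 * p ^ 2 \<le> n\<close>, so at least half of the vertices remain for the independent
    set, while \<open>p\<close> is at least \<open>sqrt n / 8\<close>. The constant 1024 is 8^3
    times 2.\<close>
  define k where "k = (\<lambda>n. nat \<lfloor>sqrt (real n) / 4\<rfloor>)"
  have "filterlim k sequentially sequentially"
    unfolding k_def by real_asymp
  then have "\<forall>\<^sub>F n in sequentially. \<exists>p. prime p \<and> k n div 2 < p \<and> p \<le> 2 * k n"
    by (rule eventually_compose_filterlim[OF eventually_prime_between])
  then show ?thesis
  proof eventually_elim
    case (elim n)
    then obtain p where p: "prime p" "k n div 2 < p" "p \<le> 2 * k n" by blast
    let ?s = "sqrt (real n)"
    have "real (k n) \<le> ?s / 4" unfolding k_def by (intro of_nat_floor) simp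
    moreover have "real p \<le> real (2 * k n)" using p(3) by (rule of_nat_mono)
    ultimately have "real p \<le> ?s / 2" by simp
    then have "real p ^ 2 \<le> (?s / 2) ^ 2" by (intro power_mono) auto
    also have "\<dots> = real n / 4" by (simp add: power_divide)
    finally have p2: "4 * real p ^ 2 \<le> real n" by simp
    then have "real (4 * p ^ 2) \<le> real n" by simp
    then have n: "4 * p ^ 2 \<le> n" by (simp only: of_nat_le_iff)
    have "?s / 4 < real (k n) + 1"
      unfolding k_def by (simp add: floor_less_iff)
    \<comment> \<open>The strict inequality on \<open>k n div 2\<close> yields the extra 1, which
      offsets the rounding in \<open>k\<close>.\<close>
    moreover have "k n + 1 \<le> 2 * p" using p(2) by linarith
    then have "real (k n + 1) \<le> real (2 * p)" by (rule of_nat_mono)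
    ultimately have "?s / 8 \<le> real p" by simp
    then have "(?s / 8) ^ 3 * (real n / 2) \<le> real p ^ 3 * (real n - 2 * real p ^ 2)"
      using p2 by (intro mult_mono power_mono) auto
    also have "\<dots> = real (p ^ 3 * (n - 2 * p ^ 2))"
      using n by (simp add: of_nat_diff)
    also have "\<dots> \<le> real (ex_complex n F4)"
      using n by (intro of_nat_mono ex_complex_F4_ge[OF p(1)]) simp
    also have "(?s / 8) ^ 3 * (real n / 2) = real n powr (5/2) / 1024"
    proof -
      have "?s ^ 3 = real n powr (3/2)"
        by (cases "n = 0") (simp_all add: powr_half_sqrt[symmetric] powr_power)
      moreover have "real n powr (5/2) = real n powr (3/2) * real n"
        using powr_add[of "real n" "3/2" 1] by simp
      ultimately show ?thesis by (simp add: power_divide)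
    qed
    finally show ?case .
  qed
qed

lemma F_hypergraph:
  assumes "F \<in> {F1, F2, F3, F4}"
  shows "hypergraph F" "{1,2} \<in> edges F"
proof -
  show "hypergraph F" using assms F_simplicial by (auto simp: abstract_simplicial_complex_def)
  show "{1,2} \<in> edges F"
    using assms by (auto simp: F1_def F2_def F3_def F4_def complex_of_def)
qed

lemma ex_complex_F_le:
  assumes "n > 0" "F \<in> {F1, F2, F3, F4}" "B \<ge> 0"
    and "\<And>K :: nat hgraph. vertex_complex K n \<Longrightarrow> free_of K F \<Longrightarrow> real (card (edges K)) \<le> B"
  shows "real (ex_complex n F) \<le> B"
proof -
  have "ex_complex n F \<le> nat \<lfloor>B\<rfloor>"
  proof (rule ex_complex_le[OF assms(1) F_hypergraph[OF assms(2)]])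
    fix K :: "nat hgraph"
    assume "abstract_simplicial_complex K" "card (verts K) = n" "free_of K F"
    then show "card (edges K) \<le> nat \<lfloor>B\<rfloor>"
      using assms(4)[of K] by (intro le_nat_floor) (simp add: vertex_complex_def)
  qed simp
  then have "real (ex_complex n F) \<le> real (nat \<lfloor>B\<rfloor>)" by (rule of_nat_mono)
  also have "\<dots> \<le> B" using assms(3) by (rule of_nat_floor)
  finally show ?thesis .
qed

lemma cube_div_3_ge: "real n ^ 3 / 27 - real n ^ 2 \<le> real (n div 3) ^ 3"
proof (cases "n \<ge> 3")
  case True
  then have n: "real n \<ge> 3" by simp
  have "real n = 3 * real (n div 3) + real (n mod 3)"
    by (metis mult.commute of_nat_add of_nat_mult of_nat_numeral div_mult_mod_eq)
  moreover have "real (n mod 3) \<le> 2" using pos_mod_bound[of 3 n] by linarith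
  ultimately have le: "(real n - 2) / 3 \<le> real (n div 3)" by simp
  \<comment> \<open>This polynomial is 27 times the amount by which \<open>((n - 2) / 3) ^ 3\<close>
    exceeds the left-hand side of the claim.\<close>
  have "0 \<le> 21 * real n ^ 2 + 12 * real n - 8"
    using n zero_le_power2[of "real n"] by linarith
  then have "real n ^ 3 / 27 - real n ^ 2 \<le>
      real n ^ 3 / 27 - real n ^ 2 + (21 * real n ^ 2 + 12 * real n - 8) / 27"
    by simp
  also have "\<dots> = ((real n - 2) / 3) ^ 3"
    by (simp add: power2_eq_square power3_eq_cube field_simps)
  also have "\<dots> \<le> real (n div 3) ^ 3"
    using n le by (intro power_mono) auto
  finally show ?thesis .
next
  case False
  then have "real n ^ 2 * real n \<le> real n ^ 2 * 27" by (intro mult_left_mono) auto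
  then have "real n ^ 3 / 27 - real n ^ 2 \<le> 0" by (simp add: power2_eq_square power3_eq_cube)
  also have "0 \<le> real (n div 3) ^ 3" by simp
  finally show ?thesis .
qed

lemma ex_complex_F12_asymp:
  assumes F: "F \<in> {F1, F2}"
  shows "(\<lambda>n. real (ex_complex n F) - real n ^ 3 / 27) \<in> o(\<lambda>n. real n ^ 3)"
proof (rule landau_o.big_small_trans)
  \<comment> \<open>The 17 collects one \<open>(n + 1) ^ 2\<close> for the small faces and 16 for
    the degenerate ones.\<close>
  have "\<bar>real (ex_complex n F) - real n ^ 3 / 27\<bar> \<le> 17 * (real n + 1) ^ 2" if n: "n > 0" for n
  proof -
    have "real (ex_complex n F) \<le> 17 * (real n + 1) ^ 2 + real n ^ 3 / 27"
    proof (rule ex_complex_F_le[OF n])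
      fix K :: "nat hgraph"
      assume K: "vertex_complex K n" and free: "free_of K F"
      from F consider "F = F1" | "F = F2" by blast
      then show "real (card (edges K)) \<le> 17 * (real n + 1) ^ 2 + real n ^ 3 / 27"
      proof cases
        case 1
        then show ?thesis
          using vertex_complex.F1_free_bound[OF K] free by (simp add: power2_eq_square algebra_simps)
      next
        case 2
        then show ?thesis
          using vertex_complex.F2_free_bound[OF K] free by (simp add: power2_eq_square algebra_simps)
      qed
    qed (use F in auto)
    moreover have "(n div 3) ^ 3 \<le> ex_complex n F" using F by (intro ex_complex_F123_ge[OF n]) auto
    then have "real (n div 3) ^ 3 \<le> real (ex_complex n F)" by (metis of_nat_le_iff of_nat_power)
    then have "real n ^ 3 / 27 - real n ^ 2 \<le> real (ex_complex n F)"
      using cube_div_3_ge[of n] by linarith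
    moreover have "real n ^ 2 \<le> 17 * (real n + 1) ^ 2"
      by (simp add: power2_eq_square algebra_simps)
    ultimately show ?thesis by linarith
  qed
  then show "(\<lambda>n. real (ex_complex n F) - real n ^ 3 / 27) \<in> O(\<lambda>n. (real n + 1) ^ 2)"
    by (intro bigoI[where c = 17] eventually_mono[OF eventually_gt_at_top[of 0]]) auto
  show "(\<lambda>n. (real n + 1) ^ 2) \<in> o(\<lambda>n. real n ^ 3)" by real_asymp
qed

lemma ex_complex_F3_bigtheta: "(\<lambda>n. real (ex_complex n F3)) \<in> \<Theta>(\<lambda>n. real n ^ 3)"
proof (rule bigthetaI)
  have "real (ex_complex n F3) \<le> (real n + 1) ^ 3 + 32 * real n ^ 2" if n: "n > 0" for n
  proof (rule ex_complex_F_le[OF n])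
    fix K :: "nat hgraph"
    assume K: "vertex_complex K n" and "free_of K F3"
    then have "real (card (edges K)) \<le> real ((n + 1) ^ 3 + 32 * n ^ 2)"
      by (intro of_nat_mono vertex_complex.F3_free_bound)
    then show "real (card (edges K)) \<le> (real n + 1) ^ 3 + 32 * real n ^ 2"
      by (simp add: add.commute[of 1])
  qed auto
  then have "(\<lambda>n. real (ex_complex n F3)) \<in> O(\<lambda>n. (real n + 1) ^ 3 + 32 * real n ^ 2)"
    by (intro bigoI[where c = 1] eventually_mono[OF eventually_gt_at_top[of 0]]) auto
  also have "(\<lambda>n. (real n + 1) ^ 3 + 32 * real n ^ 2) \<in> O(\<lambda>n. real n ^ 3)" by real_asymp
  finally show "(\<lambda>n. real (ex_complex n F3)) \<in> O(\<lambda>n. real n ^ 3)" .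
next
  have "\<forall>\<^sub>F n in sequentially. real n ^ 3 / 54 \<le> real n ^ 3 / 27 - real n ^ 2" by real_asymp
  then have "\<forall>\<^sub>F n in sequentially. (1/54) * norm (real n ^ 3) \<le> norm (real (ex_complex n F3))"
    using eventually_gt_at_top[of 0]
  proof eventually_elim
    case (elim n)
    have "real (n div 3) ^ 3 \<le> real (ex_complex n F3)"
      using ex_complex_F123_ge[of n F3] elim by (metis insertCI of_nat_le_iff of_nat_power)
    then have "real n ^ 3 / 54 \<le> real (ex_complex n F3)"
      using elim(1) cube_div_3_ge[of n] by linarith
    then show ?case by simp
  qed
  then show "(\<lambda>n. real (ex_complex n F3)) \<in> \<Omega>(\<lambda>n. real n ^ 3)"
    by (intro landau_omega.bigI[of "1/54"]) auto
qed

lemma ex_complex_F4_bigomega: "(\<lambda>n. real (ex_complex n F4)) \<in> \<Omega>(\<lambda>n. real n powr (5/2))"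
proof (rule landau_omega.bigI[of "1/1024"])
  show "\<forall>\<^sub>F n in sequentially. norm (real (ex_complex n F4)) \<ge> 1/1024 * norm (real n powr (5/2))"
    using eventually_ex_complex_F4_ge by eventually_elim simp
qed simp

lemma ex_complex_F4_bigo: "(\<lambda>n. real (ex_complex n F4)) \<in> O(\<lambda>n. real n powr (15/4))"
proof -
  have "real (ex_complex n F4) \<le> (real n + 1) ^ 3 + 4 * real n powr (15/4)" if n: "n > 0" for n
    by (rule ex_complex_F_le[OF n]) (auto intro: vertex_complex.F4_free_bound)
  then have "(\<lambda>n. real (ex_complex n F4)) \<in> O(\<lambda>n. (real n + 1) ^ 3 + 4 * real n powr (15/4))"
    by (intro bigoI[where c = 1] eventually_mono[OF eventually_gt_at_top[of 0]]) auto
  also have "(\<lambda>n. (real n + 1) ^ 3 + 4 * real n powr (15/4)) \<in> O(\<lambda>n. real n powr (15/4))"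
    by real_asymp
  finally show ?thesis .
qed

text \<open>Both the clique count and the binomial sum are quadratic in \<open>n\<close>. The
  threshold is the lower bound for \<open>F4\<close>, the weakest of the four, so one lemma serves
  all complexes.\<close>

lemma not_trivial_of_superquadratic:
  assumes "F \<in> {F1, F2, F3, F4}" "\<forall>\<^sub>F n in sequentially. real n powr (5/2) / 1024 \<le> real (ex_complex n F)"
  shows "\<not> trivial_complex F"
proof
  assume "trivial_complex F"
  then have "\<forall>\<^sub>F n in sequentially.
      ex_complex n F = ex3_clique n (uniform_part 3 F) + (\<Sum>r=0..2. n choose r)"
    by (simp add: trivial_complex_def)
  moreover have "\<forall>\<^sub>F n in sequentially. 8 * (real n + 1) ^ 2 + (1 + real n + real n ^ 2)
      < real n powr (5/2) / 1024"
    by real_asymp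
  ultimately have "\<forall>\<^sub>F n :: nat in sequentially. False"
    using assms(2)
  proof eventually_elim
    case (elim n)
    have "(\<Sum>r=0..2. n choose r) = 1 + n + (n choose 2)"
      by (simp add: numeral_2_eq_2)
    moreover have "n choose 2 \<le> n ^ 2"
      unfolding choose_two power2_eq_square by (rule order_trans[OF div_le_dividend]) simp
    moreover have "ex3_clique n (uniform_part 3 F) \<le> 8 * (n + 1) ^ 2"
      by (rule ex3_clique_F_le[OF assms(1)])
    ultimately have "ex_complex n F \<le> 8 * (n + 1) ^ 2 + (1 + n + n ^ 2)"
      using elim(1) by linarith
    then have "real (ex_complex n F) \<le> real (8 * (n + 1) ^ 2 + (1 + n + n ^ 2))"
      by (rule of_nat_mono)
    also have "\<dots> = 8 * (real n + 1) ^ 2 + (1 + real n + real n ^ 2)" by (simp add: add.commute[of 1])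
    finally have "real (ex_complex n F) \<le> 8 * (real n + 1) ^ 2 + (1 + real n + real n ^ 2)" .
    then show False using elim(2,3) by linarith
  qed
  then show False by simp
qed

lemma eventually_ex_complex_F123_ge:
  assumes "F \<in> {F1, F2, F3}"
  shows "\<forall>\<^sub>F n in sequentially. real n powr (5/2) / 1024 \<le> real (ex_complex n F)"
proof -
  have "\<forall>\<^sub>F n in sequentially. real n powr (5/2) / 1024 \<le> real n ^ 3 / 27 - real n ^ 2" by real_asymp
  then show ?thesis
    using eventually_gt_at_top[of 0]
  proof eventually_elim
    case (elim n)
    have "real (n div 3) ^ 3 \<le> real (ex_complex n F)"
      using ex_complex_F123_ge[of n F] elim assms by (metis of_nat_le_iff of_nat_power)
    then show ?case using elim(1) cube_div_3_ge[of n] by linarith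
  qed
qed

theorem theorem1p8:
  shows "\<not> trivial_complex F1 \<and> \<not> trivial_complex F2 \<and>
         \<not> trivial_complex F3 \<and> \<not> trivial_complex F4 \<and>
         (\<lambda>n. real (ex_complex n F1) - real n ^ 3 / 27) \<in> o(\<lambda>n. real n ^ 3) \<and>
         (\<lambda>n. real (ex_complex n F2) - real n ^ 3 / 27) \<in> o(\<lambda>n. real n ^ 3) \<and>
         (\<lambda>n. real (ex_complex n F3)) \<in> \<Theta>(\<lambda>n. real n ^ 3) \<and>
         (\<lambda>n. real (ex_complex n F4)) \<in> \<Omega>(\<lambda>n. real n powr (5/2)) \<and>
         (\<lambda>n. real (ex_complex n F4)) \<in> O(\<lambda>n. real n powr (15/4))"
  using not_trivial_of_superquadratic eventually_ex_complex_F123_ge eventually_ex_complex_F4_ge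
    ex_complex_F12_asymp ex_complex_F3_bigtheta ex_complex_F4_bigomega ex_complex_F4_bigo
  by (intro conjI) simp_all

end
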